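(* Let $\mathcal{F}$ be the class of degree-$d$ polynomials over $\mathbb{F}_2$ on $n$ variables. Then for every $\varepsilon>0$ there exists an explicit pseudorandom generator for $\mathcal{F}$ with error $\varepsilon$ and seed length \[ 2^{O(d)}\cdot\log^3(\log(n)/\varepsilon)\cdot\log(n/\varepsilon). \]
   Context: A degree-$d$ polynomial $p:\mathbb{F}_2^n\to\mathbb{F}_2$ is regarded as the Boolean function $f(\mathbf{x})=(-1)^{p(\mathbf{x})}$ (identifying $\{-1,1\}$-valued inputs with $\mathbb{F}_2$ via $1\mapsto0$, $-1\mapsto1$). A PRG for $\mathcal{F}$ with error $\varepsilon$ is a random variable $\mathbf{X}\in\{-1,1\}^n$ with $|\mathbb{E}[f(\mathbf{X})]-\mathbb{E}[f(\mathbf{U}_n)]|\le\varepsilon$ for all $f\in\mathcal{F}$, $\mathbf{U}_n$ uniform; it is explicit with seed length $s$ if $\mathbf{X}=G(\mathbf{U}_s)$ for an explicit (efficiently computable) $G:\{-1,1\}^s\to\{-1,1\}^n$. *)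

theory Defs
  imports
    "HOL-Probability.Probability_Mass_Function"
    "HOL-Library.Z2"
    "HOL-Library.Poly_Mapping"
begin

section \<open>Polynomials over the two-element field as Boolean functions\<close>

text \<open>
  A point of the cube $\{-1,1\}^n$ is a list of length \<open>n\<close> over \<^typ>\<open>bit\<close>, the field with
  two elements, under the identification of $1$ with \<open>0\<close> and of $-1$ with \<open>1\<close>.
\<close>

definition cube :: "nat \<Rightarrow> bit list set" where
  "cube n = {x. length x = n}"

text \<open>A polynomial maps exponent vectors to coefficients, both finitely supported.\<close>

type_synonym f2_mpoly = "(nat \<Rightarrow>\<^sub>0 nat) \<Rightarrow>\<^sub>0 bit"

definition poly_vars :: "f2_mpoly \<Rightarrow> nat set" where
  "poly_vars p = (\<Union>m\<in>Poly_Mapping.keys p. Poly_Mapping.keys m)"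

definition degree_at_most :: "nat \<Rightarrow> f2_mpoly \<Rightarrow> bool" where
  "degree_at_most d p \<longleftrightarrow>
     (\<forall>m\<in>Poly_Mapping.keys p. (\<Sum>i\<in>Poly_Mapping.keys m. Poly_Mapping.lookup m i) \<le> d)"

definition eval_poly :: "f2_mpoly \<Rightarrow> bit list \<Rightarrow> bit" where
  "eval_poly p x =
     (\<Sum>m\<in>Poly_Mapping.keys p.
        Poly_Mapping.lookup p m * (\<Prod>i\<in>Poly_Mapping.keys m. (x ! i) ^ Poly_Mapping.lookup m i))"

definition sign :: "bit \<Rightarrow> real" where
  "sign b = (if b = 1 then -1 else 1)"

definition f2_polys :: "nat \<Rightarrow> nat \<Rightarrow> (bit list \<Rightarrow> real) set" where
  "f2_polys d n =
     {(\<lambda>x. sign (eval_poly p x)) | p. poly_vars p \<subseteq> {..<n} \<and> degree_at_most d p}"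


section \<open>Pseudorandom generators\<close>

definition uniform :: "nat \<Rightarrow> bit list pmf" where
  "uniform n = pmf_of_set (cube n)"

definition is_prg :: "(bit list \<Rightarrow> real) set \<Rightarrow> nat \<Rightarrow> real \<Rightarrow> bit list pmf \<Rightarrow> bool" where
  "is_prg F n \<epsilon> X \<longleftrightarrow>
     set_pmf X \<subseteq> cube n \<and>
     (\<forall>f\<in>F. \<bar>measure_pmf.expectation X f - measure_pmf.expectation (uniform n) f\<bar> \<le> \<epsilon>)"


section \<open>Efficient computation\<close>

text \<open>
  The machine model is that of structured programs over finitely many stacks of bits, with unit
  cost per step. Two stacks simulate a Turing machine tape and a tape simulates a stack, step by
  step with constant overhead, so that polynomial running time here is polynomial running time on
  a multitape Turing machine.
\<close>

datatype prog =
    Skip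
  | Push nat bit
  | Pop nat
  | Seq prog prog
  | If_Top nat bit prog prog
  | While_Nonempty nat prog

type_synonym store = "nat \<Rightarrow> bit list"

text \<open>
  \<open>exec c \<sigma> t \<sigma>'\<close>: started in \<open>\<sigma>\<close>, the program \<open>c\<close> halts in \<open>\<sigma>'\<close> after \<open>t\<close> steps.
  The head of a list is the top of the stack; popping an empty stack has no effect.
\<close>

inductive exec :: "prog \<Rightarrow> store \<Rightarrow> nat \<Rightarrow> store \<Rightarrow> bool" where
  Skip: "exec Skip \<sigma> 1 \<sigma>"
| Push: "exec (Push r b) \<sigma> 1 (\<sigma>(r := b # \<sigma> r))"
| Pop: "exec (Pop r) \<sigma> 1 (\<sigma>(r := tl (\<sigma> r)))"
| Seq: "exec c \<sigma> t \<sigma>' \<Longrightarrow> exec c' \<sigma>' t' \<sigma>'' \<Longrightarrow> exec (Seq c c') \<sigma> (t + t') \<sigma>''"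
| If_True: "\<sigma> r \<noteq> [] \<and> hd (\<sigma> r) = b \<Longrightarrow> exec c \<sigma> t \<sigma>' \<Longrightarrow>
    exec (If_Top r b c c') \<sigma> (t + 1) \<sigma>'"
| If_False: "\<not> (\<sigma> r \<noteq> [] \<and> hd (\<sigma> r) = b) \<Longrightarrow> exec c' \<sigma> t \<sigma>' \<Longrightarrow>
    exec (If_Top r b c c') \<sigma> (t + 1) \<sigma>'"
| While_False: "\<sigma> r = [] \<Longrightarrow> exec (While_Nonempty r c) \<sigma> 1 \<sigma>"
| While_True: "\<sigma> r \<noteq> [] \<Longrightarrow> exec c \<sigma> t \<sigma>' \<Longrightarrow> exec (While_Nonempty r c) \<sigma>' t' \<sigma>'' \<Longrightarrow>
    exec (While_Nonempty r c) \<sigma> (t + t' + 1) \<sigma>''"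

text \<open>The arguments are supplied on stacks \<open>0, 1, \<dots>\<close>; the result is left on stack \<open>0\<close>.\<close>

definition initial_store :: "bit list list \<Rightarrow> store" where
  "initial_store args r = (if r < length args then args ! r else [])"

definition computes_within :: "prog \<Rightarrow> bit list list \<Rightarrow> bit list \<Rightarrow> nat \<Rightarrow> bool" where
  "computes_within c args y T \<longleftrightarrow>
     (\<exists>t \<sigma>. exec c (initial_store args) t \<sigma> \<and> \<sigma> 0 = y \<and> t \<le> T)"

definition unary :: "nat \<Rightarrow> bit list" where
  "unary n = replicate n 1"

text \<open>
  A program can only be given a finite description of the real number \<open>\<epsilon>\<close>. It is given \<open>\<epsilon>\<close> up to
  a factor of two, through the following number \<open>k\<close>: if \<open>\<epsilon> < 2\<close>, then \<open>k \<ge> 1\<close> and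
  $2^{1-k} \le \varepsilon < 2^{2-k}$; and \<open>k = 0\<close> iff \<open>\<epsilon> \<ge> 2\<close>, where an error of \<open>\<epsilon>\<close> is no
  restriction, since the functions to be fooled take values in $\{-1,1\}$.
\<close>

definition precision :: "real \<Rightarrow> nat" where
  "precision \<epsilon> = nat \<lceil>log 2 (2 / \<epsilon>)\<rceil>"

text \<open>
  A family of generators \<open>G n d \<epsilon>\<close> of seed length \<open>s n d \<epsilon>\<close> is explicit if one program computes
  all of its members and another one computes their seed lengths, both in polynomial time.
  Time is measured in the total length of parameters (in unary) and seed. So \<open>\<epsilon>\<close> contributes
  about $\log(1/\varepsilon)$, and the running time is not merely polynomial in $1/\varepsilon$.
\<close>

definition explicit ::
  "(nat \<Rightarrow> nat \<Rightarrow> real \<Rightarrow> nat) \<Rightarrow> (nat \<Rightarrow> nat \<Rightarrow> real \<Rightarrow> bit list \<Rightarrow> bit list) \<Rightarrow> bool" where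
  "explicit s G \<longleftrightarrow>
     (\<exists>gen_prog len_prog c. \<forall>n\<ge>1. \<forall>d. \<forall>\<epsilon>>0.
        let k = precision \<epsilon>; T = c * (n + d + k + s n d \<epsilon> + 1) ^ c in
        computes_within len_prog [unary n, unary d, unary k] (unary (s n d \<epsilon>)) T \<and>
        (\<forall>u\<in>cube (s n d \<epsilon>).
           computes_within gen_prog [unary n, unary d, unary k, u] (G n d \<epsilon> u) T))"


section \<open>Logarithms in seed lengths\<close>

text \<open>
  As usual in asymptotic bounds, a logarithm is understood to be at least one: otherwise the
  bound would degenerate for \<open>n = 1\<close> and for \<open>\<epsilon>\<close> close to or above \<open>1\<close>. For \<open>n \<ge> 2\<close> and
  \<open>\<epsilon> \<le> 1/2\<close>, all of the logarithms occurring are plain binary ones.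
\<close>

definition lg :: "real \<Rightarrow> real" where
  "lg x = max 1 (log 2 x)"

end

theory Submission
  imports Defs
begin

text \<open>
  By Viola's theorem, the sum of \<open>d\<close> independent generators of small bias fools polynomials of
  degree \<open>d\<close>. If \<open>p\<close> is noticeably biased, then its sign is an average of signs of differences
  of \<open>p\<close>, which have degree \<open>d - 1\<close>. If \<open>p\<close> is nearly unbiased, then the Cauchy-Schwarz inequality
  over the last summand again leaves differences of \<open>p\<close>, and the remaining average over two copies
  of the last summand is bounded through the Fourier coefficients of the sign of \<open>p\<close>. One step turns
  an error of \<open>e\<close> into \<open>4 \<surd>e\<close>, so a bias of about \<open>\<epsilon>\<close> to the power \<open>2\<^sup>d\<close> suffices.

  A small bias is reached by adding independent copies of a generator of bias \<open>13/16\<close> with a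
  seed of length \<open>O(log n)\<close>. It hashes an index with a pairwise independent hash function and looks up
  the number of leading zeros of the hash in a random table. All in all, the seed length
  is \<open>2\<^sup>O\<^sup>(\<^sup>d\<^sup>) log (1/\<epsilon>) log n\<close>.
\<close>

text \<open>The stated bound leaves room for the product of log (1/\<epsilon>) and log n, so the
  bias may be reduced by plain repetition, each copy costing O(log n) bits of seed. This decides the
  choice of the small-bias generator: hashing and table lookup use only additions of bits and the
  popping of stacks, which the machine performs directly, whereas the usual constructions compute in
  a large finite field and have to provide an irreducible polynomial first. The obstacle to constant
  bias is that a parity may run over a set S of outputs of any size. It is unbiased once an odd
  number of elements of S look up one and the same table entry. Leading zeros spread the lookups
  over levels with geometrically decreasing probabilities, so for every S some level is expected to
  receive between 1/4 and 1/2 of an element. Explicitness allows time polynomial in the seed length.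
  The generator never computes the number of copies; it reads its seed to the end, and the doubly
  exponential loss in the error appears only in the length of the seed.\<close>

declare add_bit_eq_xor [simp del] mult_bit_eq_and [simp del] power_bit_unfold [simp del]

section \<open>Bits and signs\<close>

lemma bit_add_self [simp]: "b + b = (0::bit)" "b + (b + c) = (c::bit)"
  by (cases b; cases c; simp)+

lemma sign_simps [simp]: "sign 0 = 1" "sign 1 = -1" "sign b * sign b = 1" "sign b * (sign b * r) = r"
  "\<bar>sign b\<bar> = 1" "(sign b)\<^sup>2 = 1"
  by (auto simp: sign_def)

lemma sign_add: "sign (a + b) = sign a * sign b"
  by (cases a; cases b; simp)

subsection \<open>Averages over finite sets\<close>

text \<open>Expectations are normalised finite sums, so that independence and exchange of averages
  become manipulations of sums; probability mass functions return only in
  \<open>expectation_uniform\<close> and \<open>gen_is_prg\<close>. Division by zero makes the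
  average over an empty or infinite set zero, which keeps most rules unconditional.\<close>

definition avg :: "'a set \<Rightarrow> ('a \<Rightarrow> real) \<Rightarrow> real" where
  "avg A f = (\<Sum>x\<in>A. f x) / card A"

lemma avg_cong: "(\<And>x. x \<in> A \<Longrightarrow> f x = g x) \<Longrightarrow> avg A f = avg A g"
  by (simp add: avg_def)

lemma avg_add: "avg A (\<lambda>x. f x + g x) = avg A f + avg A g"
  by (simp add: avg_def sum.distrib add_divide_distrib)

lemma avg_diff: "avg A (\<lambda>x. f x - g x) = avg A f - avg A g"
  by (simp add: avg_def sum_subtractf diff_divide_distrib)

lemma avg_cmult: "avg A (\<lambda>x. c * f x) = c * avg A f"
  by (simp add: avg_def sum_distrib_left)

lemma avg_multc: "avg A (\<lambda>x. f x * c) = avg A f * c"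
  by (simp add: avg_def sum_distrib_right)

lemma avg_sum: "avg A (\<lambda>x. \<Sum>i\<in>I. f i x) = (\<Sum>i\<in>I. avg A (f i))"
  unfolding avg_def by (subst sum.swap) (simp add: sum_divide_distrib)

lemma avg_const: "finite A \<Longrightarrow> A \<noteq> {} \<Longrightarrow> avg A (\<lambda>x. c) = c"
  by (simp add: avg_def)

lemma avg_mono: "(\<And>x. x \<in> A \<Longrightarrow> f x \<le> g x) \<Longrightarrow> avg A f \<le> avg A g"
  by (simp add: avg_def divide_right_mono sum_mono)

lemma avg_le_const:
  assumes "finite A" "A \<noteq> {}" "\<And>x. x \<in> A \<Longrightarrow> f x \<le> c"
  shows "avg A f \<le> c"
  using avg_mono[of A f "\<lambda>_. c"] assms by (simp add: avg_const)

lemma abs_avg_le: "\<bar>avg A f\<bar> \<le> avg A (\<lambda>x. \<bar>f x\<bar>)"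
  by (simp add: avg_def divide_right_mono sum_abs)

lemma avg_swap: "avg A (\<lambda>x. avg B (f x)) = avg B (\<lambda>y. avg A (\<lambda>x. f x y))"
  unfolding avg_def sum_divide_distrib[symmetric]
  by (subst sum.swap) (simp add: mult.commute)

lemma avg_mult_avg: "avg A f * avg B g = avg A (\<lambda>x. avg B (\<lambda>y. f x * g y))"
  by (simp add: avg_cmult avg_multc)

lemma avg_square: "(avg A f)\<^sup>2 = avg A (\<lambda>x. avg A (\<lambda>y. f x * f y))"
  by (simp add: power2_eq_square avg_mult_avg)

lemma avg_reindex: "bij_betw h A B \<Longrightarrow> avg B f = avg A (\<lambda>x. f (h x))"
  unfolding avg_def by (simp add: bij_betw_same_card sum.reindex_bij_betw)

text \<open>Nonnegativity of the variance; this is the form of Cauchy-Schwarz used in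
  \<open>fools_Suc\<close>.\<close>

lemma avg_square_le:
  assumes "finite A" "A \<noteq> {}"
  shows "(avg A f)\<^sup>2 \<le> avg A (\<lambda>x. (f x)\<^sup>2)"
proof -
  have "0 \<le> avg A (\<lambda>x. (f x - avg A f)\<^sup>2)"
    by (simp add: avg_def sum_nonneg)
  also have "(\<lambda>x. (f x - avg A f)\<^sup>2) = (\<lambda>x. ((f x)\<^sup>2 - (2 * avg A f) * f x) + (avg A f)\<^sup>2)"
    by (simp add: power2_diff algebra_simps)
  also have "avg A \<dots> = avg A (\<lambda>x. (f x)\<^sup>2) - (avg A f)\<^sup>2"
    using assms by (simp add: avg_add avg_diff avg_cmult avg_const power2_eq_square)
  finally show ?thesis by simp
qed

subsection \<open>The cube as a vector space\<close>

lemma finite_cube [simp]: "finite (cube n)"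
  and card_cube: "card (cube n) = 2 ^ n"

proof -
  have U: "(UNIV :: bit set) = {0, 1}" by (metis (full_types) UNIV_eq_I bit.exhaust insertCI)
  have f: "finite (UNIV :: bit set)" and c: "card (UNIV :: bit set) = 2" unfolding U by simp_all
  show "finite (cube n)" "card (cube n) = 2 ^ n"
    using finite_lists_length_eq[OF f, of n] card_lists_length_eq[OF f, of n] c by (simp_all add: cube_def)
qed

lemma mem_cube [simp]: "x \<in> cube n \<longleftrightarrow> length x = n"
  by (simp add: cube_def)

lemma cube_nonempty [simp]: "cube n \<noteq> {}"
  using card_cube[of n] by auto

text \<open>A uniform string cut at a fixed place consists of two independent uniform
  strings.\<close>

lemma avg_cube_add: "avg (cube (m + n)) f = avg (cube m) (\<lambda>x. avg (cube n) (\<lambda>y. f (x @ y)))"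
proof -
  have "bij_betw (\<lambda>(x, y). x @ y) (cube m \<times> cube n) (cube (m + n))"
    by (rule bij_betw_byWitness[where f' = "\<lambda>u. (take m u, drop m u)"]) auto
  from avg_reindex[OF this] have "avg (cube (m + n)) f = avg (cube m \<times> cube n) (\<lambda>z. f (case z of (x, y) \<Rightarrow> x @ y))" .
  also have "\<dots> = (\<Sum>x\<in>cube m. \<Sum>y\<in>cube n. f (x @ y)) / (card (cube m) * card (cube n))"
    by (simp add: avg_def card_cartesian_product sum.cartesian_product split_beta)
  finally show ?thesis
    by (simp add: avg_def sum_divide_distrib[symmetric] mult.commute)
qed

definition vadd :: "bit list \<Rightarrow> bit list \<Rightarrow> bit list" where
  "vadd x y = map2 (+) x y"

lemma nth_vadd [simp]: "i < length x \<Longrightarrow> length y = length x \<Longrightarrow> vadd x y ! i = x ! i + y ! i"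
  by (simp add: vadd_def)

lemma length_vadd [simp]: "length (vadd x y) = min (length x) (length y)"
  by (simp add: vadd_def)

lemma vadd_commute: "length x = length y \<Longrightarrow> vadd x y = vadd y x"
  by (intro nth_equalityI) (auto simp: add.commute)

lemma vadd_assoc: "length x = length y \<Longrightarrow> length y = length z \<Longrightarrow> vadd (vadd x y) z = vadd x (vadd y z)"
  by (intro nth_equalityI) (auto simp: add.assoc)

lemma vadd_cancel: "length x = length y \<Longrightarrow> vadd (vadd x y) y = x"
  by (intro nth_equalityI) (auto simp: add.assoc)

lemma avg_shift:
  assumes "a \<in> cube n"
  shows "avg (cube n) (\<lambda>x. f (vadd x a)) = avg (cube n) f"
proof -
  have "bij_betw (\<lambda>x. vadd x a) (cube n) (cube n)"
    by (rule bij_betw_byWitness[where f' = "\<lambda>x. vadd x a"]) (use assms in \<open>auto simp: vadd_cancel\<close>)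
  then show ?thesis
    by (rule avg_reindex[symmetric])
qed

section \<open>Characters of the cube and coordinate flips\<close>

definition dot :: "bit list \<Rightarrow> bit list \<Rightarrow> bit" where
  "dot a x = (\<Sum>i<length a. a ! i * x ! i)"

lemma dot_commute: "length a = length x \<Longrightarrow> dot a x = dot x a"
  by (simp add: dot_def mult.commute)

lemma dot_vadd: "length x = length a \<Longrightarrow> length y = length a \<Longrightarrow> dot a (vadd x y) = dot a x + dot a y"
  by (simp add: dot_def algebra_simps sum.distrib)

text \<open>An involution of the cube that carries all symmetry arguments: a function negated by it
  averages to zero, and a condition toggled by it holds at exactly half of the points.\<close>

definition flip :: "nat \<Rightarrow> bit list \<Rightarrow> bit list" where
  "flip i x = x[i := x ! i + 1]"

lemma length_flip [simp]: "length (flip i x) = length x"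
  by (simp add: flip_def)

lemma nth_flip: "i < length x \<Longrightarrow> flip i x ! j = (if j = i then x ! i + 1 else x ! j)"
  by (simp add: flip_def)

lemma flip_flip [simp]: "flip i (flip i x) = x"
  by (cases "i < length x") (auto simp: flip_def add.assoc list_update_beyond)

lemma avg_flip: "avg (cube n) (\<lambda>x. f (flip i x)) = avg (cube n) f"
proof -
  have "bij_betw (flip i) (cube n) (cube n)"
    by (rule bij_betw_byWitness[where f' = "flip i"]) auto
  then show ?thesis
    by (rule avg_reindex[symmetric])
qed

lemma avg_sign_flip:
  assumes "\<And>x. x \<in> cube n \<Longrightarrow> f (flip i x) = f x + 1"
  shows "avg (cube n) (\<lambda>x. sign (f x)) = 0"
proof -
  have "avg (cube n) (\<lambda>x. sign (f x)) = avg (cube n) (\<lambda>x. sign (f (flip i x)))"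
    using avg_flip[of n "\<lambda>x. sign (f x)" i] by simp
  also have "\<dots> = avg (cube n) (\<lambda>x. (-1) * sign (f x))"
    by (rule avg_cong) (simp add: assms sign_add)
  finally show ?thesis by (simp only: avg_cmult)
qed

lemma avg_sign_dot:
  assumes "a \<in> cube n"
  shows "avg (cube n) (\<lambda>x. sign (dot a x)) = (if a = replicate n 0 then 1 else 0)"
proof (cases "a = replicate n 0")
  case True
  then have "dot a x = 0" for x by (simp add: dot_def)
  then show ?thesis using True by (simp add: avg_const)
next
  case False
  then obtain i where i: "i < n" "a ! i = 1"
    using assms by (auto simp: list_eq_iff_nth_eq)
  have "dot a (flip i x) = dot a x + 1" if "x \<in> cube n" for x
  proof -
    have "dot a y = y ! i + (\<Sum>j\<in>{..<n} - {i}. a ! j * y ! j)" for y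
      unfolding dot_def using i assms by (simp add: sum.remove[of "{..<n}" i])
    then show ?thesis
      using i that by (simp add: nth_flip add_ac)
  qed
  then show ?thesis
    using False avg_sign_flip[of n "dot a" i] by simp
qed

subsection \<open>Fourier expansion of the autocorrelation\<close>

definition fourier :: "nat \<Rightarrow> (bit list \<Rightarrow> real) \<Rightarrow> bit list \<Rightarrow> real" where
  "fourier n f a = avg (cube n) (\<lambda>x. f x * sign (dot a x))"

text \<open>Expanding the squared coefficients as averages over pairs \<open>x\<close>,
  \<open>y\<close> and summing over all characters \<open>a\<close>, orthogonality leaves only the
  pairs with \<open>y = x + h\<close>. The case \<open>h = 0\<close> is Parseval's identity.\<close>

lemma autocorrelation:
  assumes h: "h \<in> cube n"
  shows "avg (cube n) (\<lambda>x. f x * f (vadd x h)) = (\<Sum>a\<in>cube n. (fourier n f a)\<^sup>2 * sign (dot a h))"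
proof -
  have orth: "(\<Sum>a\<in>cube n. sign (dot a z)) = (if z = replicate n 0 then 2 ^ n else 0)" if z: "z \<in> cube n" for z
  proof -
    have "(\<Sum>a\<in>cube n. sign (dot a z)) = 2 ^ n * avg (cube n) (\<lambda>a. sign (dot z a))"
      using z by (simp add: avg_def card_cube dot_commute[of _ z])
    then show ?thesis by (simp add: avg_sign_dot[OF z])
  qed
  have eq: "vadd (vadd x y) h = replicate n 0 \<longleftrightarrow> y = vadd x h" if "x \<in> cube n" "y \<in> cube n" for x y
  proof
    assume *: "vadd (vadd x y) h = replicate n 0"
    show "y = vadd x h"
    proof (rule nth_equalityI)
      fix i assume i: "i < length y"
      then have "x ! i + y ! i + h ! i = 0"
        using arg_cong[OF *, of "\<lambda>l. l ! i"] that h by simp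
      then show "y ! i = vadd x h ! i"
        using i that h by (cases "x ! i"; cases "y ! i"; cases "h ! i") auto
    qed (use that h in auto)
  next
    assume "y = vadd x h"
    then show "vadd (vadd x y) h = replicate n 0"
      using that h by (intro nth_equalityI) (auto simp: add_ac)
  qed
  have "(\<Sum>a\<in>cube n. (fourier n f a)\<^sup>2 * sign (dot a h)) =
      (\<Sum>a\<in>cube n. avg (cube n) (\<lambda>x. avg (cube n) (\<lambda>y. f x * f y * sign (dot a (vadd (vadd x y) h)))))"
  proof (rule sum.cong[OF refl])
    fix a assume a: "a \<in> cube n"
    show "(fourier n f a)\<^sup>2 * sign (dot a h) =
        avg (cube n) (\<lambda>x. avg (cube n) (\<lambda>y. f x * f y * sign (dot a (vadd (vadd x y) h))))"
      unfolding fourier_def avg_square avg_multc[symmetric]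
      by (intro avg_cong) (use a h in \<open>simp add: dot_vadd sign_add\<close>)
  qed
  also have "\<dots> = avg (cube n) (\<lambda>x. avg (cube n) (\<lambda>y. f x * f y * (\<Sum>a\<in>cube n. sign (dot a (vadd (vadd x y) h)))))"
    by (simp add: avg_sum[symmetric] sum_distrib_left)
  also have "\<dots> = avg (cube n) (\<lambda>x. avg (cube n) (\<lambda>y. f x * f y * (if y = vadd x h then 2 ^ n else 0)))"
    by (intro avg_cong) (use h in \<open>simp add: orth eq\<close>)
  also have "\<dots> = avg (cube n) (\<lambda>x. f x * f (vadd x h))"
  proof (rule avg_cong)
    fix x assume x: "x \<in> cube n"
    have "avg (cube n) (\<lambda>y. f x * f y * (if y = vadd x h then 2 ^ n else 0)) =
        (\<Sum>y\<in>cube n. if y = vadd x h then f x * f y * 2 ^ n else 0) / 2 ^ n"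
      by (simp add: avg_def card_cube if_distrib cong: if_cong)
    also have "\<dots> = f x * f (vadd x h)"
      using x h by simp
    finally show "avg (cube n) (\<lambda>y. f x * f y * (if y = vadd x h then 2 ^ n else 0)) = f x * f (vadd x h)" .
  qed
  finally show ?thesis by simp
qed

lemma avg_Times: "avg (A \<times> B) f = avg A (\<lambda>x. avg B (\<lambda>y. f (x, y)))"
  by (simp add: avg_def card_cartesian_product sum.cartesian_product
      sum_divide_distrib[symmetric] mult.commute)

subsection \<open>Degree by iterated differences\<close>

definition diff :: "bit list \<Rightarrow> (bit list \<Rightarrow> bit) \<Rightarrow> bit list \<Rightarrow> bit" where
  "diff a p x = p (vadd x a) + p x"

text \<open>Degree is a property of functions on the cube, not of expressions: all
  \<open>d\<close>-fold differences are constant. Differencing then lowers the degree by definition,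
  and the induction on the degree handles only differences and translates.\<close>

fun deg_le :: "nat \<Rightarrow> nat \<Rightarrow> (bit list \<Rightarrow> bit) \<Rightarrow> bool" where
  "deg_le n 0 p \<longleftrightarrow> (\<exists>c. \<forall>x\<in>cube n. p x = c)"
| "deg_le n (Suc d) p \<longleftrightarrow> (\<forall>a\<in>cube n. deg_le n d (diff a p))"

lemma deg_le_cong: "(\<And>x. x \<in> cube n \<Longrightarrow> p x = q x) \<Longrightarrow> deg_le n d p \<Longrightarrow> deg_le n d q"
proof (induction d arbitrary: p q)
  case (Suc d)
  have "deg_le n d (diff a q)" if a: "a \<in> cube n" for a
  proof (rule Suc.IH)
    show "deg_le n d (diff a p)" using Suc.prems a by simp
  qed (use Suc.prems a in \<open>simp add: diff_def\<close>)
  then show ?case by simp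
qed auto

text \<open>Translations commute with differences.\<close>

lemma deg_le_shift:
  assumes "deg_le n d p" "z \<in> cube n"
  shows "deg_le n d (\<lambda>x. p (vadd x z))"
  using assms(1)
proof (induction d arbitrary: p)
  case 0
  then show ?case using assms(2) by fastforce
next
  case (Suc d)
  have "deg_le n d (diff a (\<lambda>x. p (vadd x z)))" if a: "a \<in> cube n" for a
  proof (rule deg_le_cong)
    show "deg_le n d (\<lambda>x. diff a p (vadd x z))"
      using Suc a by simp
    fix x assume "x \<in> cube n"
    then have "vadd (vadd x z) a = vadd (vadd x a) z"
      using a assms(2) by (simp add: vadd_assoc vadd_commute[of z])
    then show "diff a p (vadd x z) = diff a (\<lambda>x. p (vadd x z)) x"
      by (simp add: diff_def)
  qed
  then show ?case by simp
qed

lemma deg_le_const: "deg_le n d (\<lambda>x. c)"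
  by (induction d arbitrary: c) (auto simp: diff_def[abs_def])

lemma deg_le_add: "deg_le n d p \<Longrightarrow> deg_le n d q \<Longrightarrow> deg_le n d (\<lambda>x. p x + q x)"
proof (induction d arbitrary: p q)
  case 0
  then show ?case by fastforce
next
  case (Suc d)
  have "diff a (\<lambda>x. p x + q x) = (\<lambda>x. diff a p x + diff a q x)" for a
    by (auto simp: diff_def add_ac)
  with Suc show ?case by simp
qed

lemma deg_le_sum: "(\<And>i. i \<in> I \<Longrightarrow> deg_le n d (p i)) \<Longrightarrow> deg_le n d (\<lambda>x. \<Sum>i\<in>I. p i x)"
  by (induction I rule: infinite_finite_induct) (auto intro: deg_le_add deg_le_const)

lemma deg_le_cmult: "deg_le n d p \<Longrightarrow> deg_le n d (\<lambda>x. c * p x)"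
  using deg_le_const[of n d 0] by (cases c) auto

lemma deg_le_Suc: "deg_le n d p \<Longrightarrow> deg_le n (Suc d) p"
proof (induction d arbitrary: p)
  case 0
  then obtain c where "\<forall>x\<in>cube n. p x = c" by auto
  then have "\<forall>a\<in>cube n. \<forall>x\<in>cube n. diff a p x = 0"
    by (auto simp: diff_def)
  then show ?case by auto
next
  case (Suc d)
  then show ?case by (metis deg_le.simps(2))
qed

lemma deg_le_mono: "d \<le> e \<Longrightarrow> deg_le n d p \<Longrightarrow> deg_le n e p"
  by (induction e rule: dec_induct) (auto intro: deg_le_Suc simp del: deg_le.simps)

text \<open>Leibniz rule: the difference of \<open>x\<^sub>i q\<close> in direction \<open>a\<close> is \<open>x\<^sub>i D q + a\<^sub>i D q + a\<^sub>i q\<close>.\<close>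

lemma deg_le_mult_coord:
  assumes "i < n"
  shows "deg_le n d q \<Longrightarrow> deg_le n (Suc d) (\<lambda>x. x ! i * q x)"
proof (induction d arbitrary: q)
  case 0
  then obtain c where "\<forall>x\<in>cube n. q x = c" by auto
  then have "\<forall>a\<in>cube n. \<forall>x\<in>cube n. diff a (\<lambda>x. x ! i * q x) x = a ! i * c"
    using assms by (simp add: diff_def algebra_simps)
  then show ?case by auto
next
  case (Suc d)
  have "deg_le n (Suc d) (diff a (\<lambda>x. x ! i * q x))" if a: "a \<in> cube n" for a
  proof (rule deg_le_cong)
    have "deg_le n d (diff a q)" using Suc.prems a by simp
    then show "deg_le n (Suc d) (\<lambda>x. (x ! i * diff a q x + a ! i * diff a q x) + a ! i * q x)"
      by (intro deg_le_add deg_le_cmult Suc.IH Suc.prems deg_le_Suc)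
    fix x assume "x \<in> cube n"
    then show "(x ! i * diff a q x + a ! i * diff a q x) + a ! i * q x = diff a (\<lambda>x. x ! i * q x) x"
      using assms a by (simp add: diff_def algebra_simps)
  qed
  then show ?case by simp
qed

lemma deg_le_mult_power:
  assumes "i < n" "deg_le n d q"
  shows "deg_le n (d + e) (\<lambda>x. (x ! i) ^ e * q x)"
  using assms(2)
proof (induction e)
  case (Suc e)
  then have "deg_le n (Suc (d + e)) (\<lambda>x. x ! i * ((x ! i) ^ e * q x))"
    by (intro deg_le_mult_coord assms(1)) auto
  then show ?case by (simp add: mult.assoc del: deg_le.simps)
qed auto

text \<open>The variables are multiplied in one at a time, so the exponents add up to the total
  degree that \<open>degree_at_most\<close> bounds.\<close>

lemma deg_le_monomial:
  assumes "finite I" "I \<subseteq> {..<n}"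
  shows "deg_le n (\<Sum>i\<in>I. e i) (\<lambda>x. \<Prod>i\<in>I. (x ! i) ^ e i)"
  using assms
proof (induction I)
  case empty
  then show ?case by simp
next
  case (insert i I)
  then have "deg_le n ((\<Sum>i\<in>I. e i) + e i) (\<lambda>x. (x ! i) ^ e i * (\<Prod>i\<in>I. (x ! i) ^ e i))"
    by (intro deg_le_mult_power) auto
  with insert show ?case by (simp add: add.commute)
qed

lemma deg_le_eval_poly:
  assumes "poly_vars p \<subseteq> {..<n}" "degree_at_most d p"
  shows "deg_le n d (eval_poly p)"
  unfolding eval_poly_def
proof (intro deg_le_sum deg_le_cmult)
  fix m assume "m \<in> Poly_Mapping.keys p"
  with assms show "deg_le n d (\<lambda>x. \<Prod>i\<in>Poly_Mapping.keys m. x ! i ^ Poly_Mapping.lookup m i)"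
    by (intro deg_le_mono[OF _ deg_le_monomial]) (auto simp: degree_at_most_def poly_vars_def)
qed

subsection \<open>Viola's theorem\<close>

text \<open>The seed ranges over a set of any type, so that the sum of two independent generators is
  simply indexed by a product; \<open>fools_reindex\<close> returns to strings.\<close>

definition fools :: "nat \<Rightarrow> nat \<Rightarrow> real \<Rightarrow> 'a set \<Rightarrow> ('a \<Rightarrow> bit list) \<Rightarrow> bool" where
  "fools n d e A y \<longleftrightarrow> (\<forall>u\<in>A. y u \<in> cube n) \<and>
    (\<forall>p. deg_le n d p \<longrightarrow>
      \<bar>avg A (\<lambda>u. sign (p (y u))) - avg (cube n) (\<lambda>x. sign (p x))\<bar> \<le> e)"

definition small_bias :: "nat \<Rightarrow> real \<Rightarrow> 'a set \<Rightarrow> ('a \<Rightarrow> bit list) \<Rightarrow> bool" where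
  "small_bias n \<delta> B z \<longleftrightarrow> (\<forall>v\<in>B. z v \<in> cube n) \<and>
    (\<forall>a\<in>cube n. a \<noteq> replicate n 0 \<longrightarrow> \<bar>avg B (\<lambda>v. sign (dot a (z v)))\<bar> \<le> \<delta>)"

lemma fools_0:
  assumes "finite A" "A \<noteq> {}" "\<forall>u\<in>A. y u \<in> cube n" "0 \<le> e"
  shows "fools n 0 e A y"
  unfolding fools_def
proof (intro conjI allI impI assms)
  fix p assume p: "deg_le n 0 p"
  then obtain c where c: "\<And>x. x \<in> cube n \<Longrightarrow> p x = c" by auto
  have "avg A (\<lambda>u. sign (p (y u))) = avg A (\<lambda>u. sign c)"
    using assms(3) c by (intro avg_cong) auto
  moreover have "avg (cube n) (\<lambda>x. sign (p x)) = avg (cube n) (\<lambda>x. sign c)"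
    using c by (intro avg_cong) auto
  ultimately show "\<bar>avg A (\<lambda>u. sign (p (y u))) - avg (cube n) (\<lambda>x. sign (p x))\<bar> \<le> e"
    using assms by (simp add: avg_const)
qed

lemma avg_sign_le_1: "finite A \<Longrightarrow> A \<noteq> {} \<Longrightarrow> \<bar>avg A (\<lambda>x. sign (f x))\<bar> \<le> 1"
  using avg_le_const[of A "\<lambda>x. \<bar>sign (f x)\<bar>" 1] abs_avg_le[of A "\<lambda>x. sign (f x)"] by simp

text \<open>
  Dividing by the bias of \<open>p\<close> writes the sign of \<open>p\<close> at every single point as an average of signs
  of polynomials of lower degree.
\<close>

lemma bias_times_diff:
  assumes "\<forall>u\<in>A. w u \<in> cube n" "finite A" "A \<noteq> {}"
  shows "avg A (\<lambda>u. sign (p (w u))) * avg (cube n) (\<lambda>x. sign (p x)) =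
    avg (cube n) (\<lambda>a. avg A (\<lambda>u. sign (diff a p (w u))))"
proof -
  \<comment> \<open>The bias is invariant under translation, so for every \<open>u\<close> it may be
    averaged over the points \<open>a + w u\<close>; the product of the two signs becomes the sign
    of the difference in direction \<open>a\<close>.\<close>
  have "avg A (\<lambda>u. sign (p (w u))) * avg (cube n) (\<lambda>x. sign (p x)) =
      avg A (\<lambda>u. avg (cube n) (\<lambda>a. sign (p (w u)) * sign (p (vadd a (w u)))))"
    unfolding avg_multc[symmetric]
    using assms by (intro avg_cong) (simp add: avg_cmult avg_shift[of _ n "\<lambda>x. sign (p x)"])
  also have "\<dots> = avg A (\<lambda>u. avg (cube n) (\<lambda>a. sign (diff a p (w u))))"
    using assms by (intro avg_cong) (simp add: diff_def sign_add vadd_commute mult.commute)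
  finally show ?thesis by (simp only: avg_swap[of "cube n"])
qed

text \<open>The inner average is the autocorrelation of the sign of \<open>p\<close> at
  \<open>z v + z v'\<close>. Averaging its Fourier expansion over \<open>v\<close> and
  \<open>v'\<close> multiplies the squared coefficient at \<open>a\<close> by the squared bias
  \<open>b a\<close>. The zero frequency contributes the squared mean of the sign; the others are
  damped by \<delta> squared, and their total mass is at most one by Parseval.\<close>

lemma convolution_small_bias:
  assumes z: "small_bias n \<delta> B z" and B: "finite B" "B \<noteq> {}" and \<delta>: "0 \<le> \<delta>"
  shows "avg B (\<lambda>v. avg B (\<lambda>v'. avg (cube n) (\<lambda>x. sign (p (vadd x (z v))) * sign (p (vadd x (z v'))))))
    \<le> (avg (cube n) (\<lambda>x. sign (p x)))\<^sup>2 + \<delta>\<^sup>2"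
proof -
  define f where "f x = sign (p x)" for x
  define b where "b a = avg B (\<lambda>v. sign (dot a (z v)))" for a
  have zc: "length (z v) = n" if "v \<in> B" for v using z that by (simp add: small_bias_def)
  have f2: "f x * f x = 1" for x by (simp add: f_def)
  have corr: "avg (cube n) (\<lambda>x. f (vadd x (z v)) * f (vadd x (z v'))) =
      (\<Sum>a\<in>cube n. (fourier n f a)\<^sup>2 * (sign (dot a (z v)) * sign (dot a (z v'))))"
    if v: "v \<in> B" "v' \<in> B" for v v'
  proof -
    \<comment> \<open>Translating \<open>x\<close> by \<open>z v\<close> cancels one shift, so that
      only \<open>z v + z v'\<close> matters.\<close>
    have "avg (cube n) (\<lambda>x. f (vadd x (z v)) * f (vadd x (z v'))) =
        avg (cube n) (\<lambda>x. f (vadd (vadd x (z v)) (z v)) * f (vadd (vadd x (z v)) (z v')))"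
      using avg_shift[of "z v" n "\<lambda>x. f (vadd x (z v)) * f (vadd x (z v'))"] v by (simp add: zc)
    also have "\<dots> = avg (cube n) (\<lambda>x. f x * f (vadd x (vadd (z v) (z v'))))"
      using v by (intro avg_cong) (simp add: zc vadd_cancel vadd_assoc)
    also have "\<dots> = (\<Sum>a\<in>cube n. (fourier n f a)\<^sup>2 * (sign (dot a (z v)) * sign (dot a (z v'))))"
      using v by (subst autocorrelation) (auto simp: zc dot_vadd sign_add)
    finally show ?thesis .
  qed
  have parseval: "(\<Sum>a\<in>cube n. (fourier n f a)\<^sup>2) = 1"
  proof -
    have "vadd x (replicate n 0) = x" if "x \<in> cube n" for x
      using that by (intro nth_equalityI) auto
    then have "avg (cube n) (\<lambda>x. f x * f (vadd x (replicate n 0))) = avg (cube n) (\<lambda>x. 1)"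
      by (intro avg_cong) (simp add: f2)
    then show ?thesis
      by (subst (asm) autocorrelation) (auto simp: dot_def avg_const)
  qed
  have "avg B (\<lambda>v. avg B (\<lambda>v'. avg (cube n) (\<lambda>x. f (vadd x (z v)) * f (vadd x (z v'))))) =
      avg B (\<lambda>v. avg B (\<lambda>v'. \<Sum>a\<in>cube n. (fourier n f a)\<^sup>2 * (sign (dot a (z v)) * sign (dot a (z v')))))"
    by (intro avg_cong corr)
  also have "\<dots> = (\<Sum>a\<in>cube n. (fourier n f a)\<^sup>2 * (b a)\<^sup>2)"
    by (simp add: avg_sum avg_cmult b_def power2_eq_square avg_mult_avg del: mem_cube)
  also have "\<dots> = (fourier n f (replicate n 0))\<^sup>2 * (b (replicate n 0))\<^sup>2
      + (\<Sum>a\<in>cube n - {replicate n 0}. (fourier n f a)\<^sup>2 * (b a)\<^sup>2)"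
    by (rule sum.remove) auto
  also have "fourier n f (replicate n 0) = avg (cube n) f"
    by (simp add: fourier_def dot_def)
  also have "b (replicate n 0) = 1"
    using B by (simp add: b_def dot_def avg_const)
  also have "(\<Sum>a\<in>cube n - {replicate n 0}. (fourier n f a)\<^sup>2 * (b a)\<^sup>2) \<le>
      (\<Sum>a\<in>cube n - {replicate n 0}. (fourier n f a)\<^sup>2 * \<delta>\<^sup>2)"
  proof (intro sum_mono mult_left_mono)
    fix a assume "a \<in> cube n - {replicate n 0}"
    then have "\<bar>b a\<bar> \<le> \<delta>" using z by (simp add: small_bias_def b_def)
    then show "(b a)\<^sup>2 \<le> \<delta>\<^sup>2" using \<delta> by (metis abs_le_square_iff abs_of_nonneg)
  qed auto
  also have "\<dots> \<le> (\<Sum>a\<in>cube n. (fourier n f a)\<^sup>2 * \<delta>\<^sup>2)"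
    by (intro sum_mono2) auto
  also have "\<dots> = \<delta>\<^sup>2"
    by (simp add: sum_distrib_right[symmetric] parseval)
  finally show ?thesis by (simp add: f_def[abs_def])
qed

text \<open>The cases split at \<open>\<bar>\<beta>\<bar> = e' / 4\<close>. Above it, dividing by
  \<beta> leaves an error of at most \<open>4 * e / e'\<close>, hence at most \<open>e' / 4\<close>.
  Below it, each of the three terms bounding \<open>W\<^sup>2\<close> is at most
  \<open>e'\<^sup>2 / 16\<close>, so \<open>W\<close> is at most \<open>e' / 2\<close> in absolute
  value. Both cases are served by \<open>16 * e \<le> e'\<^sup>2\<close>.\<close>

theorem fools_Suc:
  assumes y: "fools n d e A y" and A: "finite A" "A \<noteq> {}"
    and z: "small_bias n \<delta> B z" and B: "finite B" "B \<noteq> {}"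
    and \<delta>: "0 \<le> \<delta>" "\<delta>\<^sup>2 \<le> e" and e': "16 * e \<le> e'\<^sup>2" "0 \<le> e'"
  shows "fools n (Suc d) e' (A \<times> B) (\<lambda>(u, v). vadd (y u) (z v))"
  unfolding fools_def
proof (intro conjI allI impI)
  have yc: "length (y u) = n" if "u \<in> A" for u using y that by (simp add: fools_def)
  have zc: "length (z v) = n" if "v \<in> B" for v using z that by (simp add: small_bias_def)
  show "\<forall>u\<in>A \<times> B. (case u of (u, v) \<Rightarrow> vadd (y u) (z v)) \<in> cube n"
    by (auto simp: yc zc)
  have fool: "\<bar>avg A (\<lambda>u. sign (q (y u))) - avg (cube n) (\<lambda>x. sign (q x))\<bar> \<le> e" if "deg_le n d q" for q
    using y that by (simp add: fools_def)
  fix p assume p: "deg_le n (Suc d) p"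
  define \<beta> where "\<beta> = avg (cube n) (\<lambda>x. sign (p x))"
  define w where "w = (\<lambda>(u, v). vadd (y u) (z v))"
  define W where "W = avg (A \<times> B) (\<lambda>t. sign (p (w t)))"
  have AB: "finite (A \<times> B)" "A \<times> B \<noteq> {}" "\<forall>t\<in>A \<times> B. w t \<in> cube n"
    using A B by (auto simp: w_def yc zc)
  have W_eq: "W = avg A (\<lambda>u. avg B (\<lambda>v. sign (p (vadd (y u) (z v)))))"
    by (simp add: W_def w_def avg_Times)
  \<comment> \<open>Both \<open>W * \<beta>\<close> and \<open>\<beta> * \<beta>\<close> are
    averages over directions \<open>a\<close> of signs of differences of \<open>p\<close>. For fixed
    \<open>a\<close> and \<open>v\<close>, the summand \<open>y u\<close> alone fools the difference
    translated by \<open>z v\<close>, with error \<open>e\<close>.\<close>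
  have biased: "\<bar>W - \<beta>\<bar> * \<bar>\<beta>\<bar> \<le> e"
  proof -
    have "W * \<beta> = avg (cube n) (\<lambda>a. avg (A \<times> B) (\<lambda>t. sign (diff a p (w t))))"
      unfolding W_def \<beta>_def by (rule bias_times_diff) (use AB in auto)
    moreover have "\<beta> * \<beta> = avg (cube n) (\<lambda>a. avg (cube n) (\<lambda>x. sign (diff a p x)))"
      unfolding \<beta>_def by (rule bias_times_diff) auto
    ultimately have "(W - \<beta>) * \<beta> = avg (cube n) (\<lambda>a.
        avg (A \<times> B) (\<lambda>t. sign (diff a p (w t))) - avg (cube n) (\<lambda>x. sign (diff a p x)))"
      by (simp add: avg_diff left_diff_distrib)
    also have "\<bar>\<dots>\<bar> \<le> e"
    proof (rule order_trans[OF abs_avg_le avg_le_const])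
      fix a assume a: "a \<in> cube n"
      have "avg (A \<times> B) (\<lambda>t. sign (diff a p (w t))) - avg (cube n) (\<lambda>x. sign (diff a p x)) =
          avg B (\<lambda>v. avg A (\<lambda>u. sign (diff a p (vadd (y u) (z v)))) - avg (cube n) (\<lambda>x. sign (diff a p x)))"
        using B by (simp add: avg_diff avg_const avg_swap[of B] avg_Times w_def)
      also have "\<bar>\<dots>\<bar> \<le> e"
      proof (rule order_trans[OF abs_avg_le avg_le_const[OF B]])
        fix v assume v: "v \<in> B"
        have "deg_le n d (\<lambda>x. diff a p (vadd x (z v)))"
          using p a v by (intro deg_le_shift) (auto simp: zc)
        from fool[OF this] avg_shift[of "z v" n "\<lambda>x. sign (diff a p x)"] v
        show "\<bar>avg A (\<lambda>u. sign (diff a p (vadd (y u) (z v)))) - avg (cube n) (\<lambda>x. sign (diff a p x))\<bar> \<le> e"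
          by (simp add: zc)
      qed
      finally show "\<bar>avg (A \<times> B) (\<lambda>t. sign (diff a p (w t))) - avg (cube n) (\<lambda>x. sign (diff a p x))\<bar> \<le> e" .
    qed auto
    finally show ?thesis by (simp add: abs_mult)
  qed
  \<comment> \<open>Only the average over \<open>v\<close> is squared, so \<open>u\<close> stays a
    single copy and can be traded for a uniform point.\<close>
  have unbiased: "W\<^sup>2 \<le> \<beta>\<^sup>2 + \<delta>\<^sup>2 + e"
  proof -
    define g where "g v v' x = sign (p (vadd x (z v))) * sign (p (vadd x (z v')))" for v v' x
    have "W\<^sup>2 \<le> avg A (\<lambda>u. (avg B (\<lambda>v. sign (p (vadd (y u) (z v)))))\<^sup>2)"
      unfolding W_eq by (rule avg_square_le[OF A])
    also have "\<dots> = avg A (\<lambda>u. avg B (\<lambda>v. avg B (\<lambda>v'. g v v' (y u))))"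
      by (simp add: avg_square g_def)
    also have "\<dots> = avg B (\<lambda>v. avg A (\<lambda>u. avg B (\<lambda>v'. g v v' (y u))))"
      by (rule avg_swap)
    also have "\<dots> = avg B (\<lambda>v. avg B (\<lambda>v'. avg A (\<lambda>u. g v v' (y u))))"
      by (subst avg_swap[of A B]) (rule refl)
    also have "\<dots> \<le> avg B (\<lambda>v. avg B (\<lambda>v'. avg (cube n) (g v v') + e))"
    proof (intro avg_mono)
      fix v v' assume v: "v \<in> B" "v' \<in> B"
      \<comment> \<open>The product of the two signs belongs to a difference of \<open>p\<close> in
        direction \<open>z v + z v'\<close>, translated by \<open>z v\<close>, and so to degree
        \<open>d\<close>.\<close>
      have "deg_le n d (\<lambda>x. diff (vadd (z v) (z v')) p (vadd x (z v)))"
        using p v by (intro deg_le_shift) (auto simp: zc)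
      then have "deg_le n d (\<lambda>x. p (vadd x (z v)) + p (vadd x (z v')))"
        by (rule deg_le_cong[rotated])
           (use v in \<open>simp add: diff_def zc vadd_assoc[symmetric] vadd_cancel add.commute\<close>)
      from fool[OF this] show "avg A (\<lambda>u. g v v' (y u)) \<le> avg (cube n) (g v v') + e"
        by (simp add: sign_add g_def[abs_def])
    qed
    also have "\<dots> = avg B (\<lambda>v. avg B (\<lambda>v'. avg (cube n) (g v v'))) + e"
      using B by (simp add: avg_add avg_const)
    also have "\<dots> \<le> \<beta>\<^sup>2 + \<delta>\<^sup>2 + e"
      using convolution_small_bias[OF z B \<delta>(1), of p] by (simp add: g_def[abs_def] \<beta>_def)
    finally show ?thesis .
  qed
  have "\<bar>W - \<beta>\<bar> \<le> e'"
  proof (cases "\<bar>\<beta>\<bar> \<le> e' / 4")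
    case True
    then have "\<beta>\<^sup>2 \<le> (e' / 4)\<^sup>2"
      by (metis abs_le_square_iff abs_of_nonneg e'(2) divide_nonneg_nonneg zero_le_numeral)
    then have "16 * \<beta>\<^sup>2 \<le> e'\<^sup>2"
      by (simp add: power_divide)
    then have "4 * W\<^sup>2 \<le> e'\<^sup>2"
      using unbiased \<delta>(2) e'(1) zero_le_power2[of e'] by linarith
    then have "W\<^sup>2 \<le> (e' / 2)\<^sup>2"
      by (simp add: power_divide)
    then have "\<bar>W\<bar> \<le> e' / 2"
      using e'(2) abs_le_square_iff[of W "e' / 2"] by simp
    then show ?thesis using True e'(2) by linarith
  next
    case False
    then have "\<bar>W - \<beta>\<bar> * (e' / 4) \<le> \<bar>W - \<beta>\<bar> * \<bar>\<beta>\<bar>"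
      by (intro mult_left_mono) auto
    also have "\<dots> \<le> e" by (rule biased)
    also have "\<dots> \<le> e' / 4 * (e' / 4)" using e'(1) by (simp add: power2_eq_square)
    finally have le: "\<bar>W - \<beta>\<bar> * (e' / 4) \<le> e' / 4 * (e' / 4)" .
    show ?thesis
    \<comment> \<open>There is no dividing by \<open>e' = 0\<close>; in that case
      \<open>e \<le> 0\<close> and \<beta> is nonzero, which forces
      \<open>W = \<beta>\<close>.\<close>
    proof (cases "e' = 0")
      case True
      with False biased e' have "\<bar>W - \<beta>\<bar> * \<bar>\<beta>\<bar> \<le> 0" "0 < \<bar>\<beta>\<bar>" by simp_all
      with e'(2) show ?thesis by (simp add: mult_le_0_iff)
    next
      case False
      with le e'(2) have "\<bar>W - \<beta>\<bar> \<le> e' / 4" by (simp add: mult_le_cancel_right)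
      with e'(2) show ?thesis by linarith
    qed
  qed
  then show "\<bar>avg (A \<times> B) (\<lambda>t. sign (p (case t of (u, v) \<Rightarrow> vadd (y u) (z v)))) - avg (cube n) (\<lambda>x. sign (p x))\<bar> \<le> e'"
    by (simp add: W_def \<beta>_def w_def)
qed

subsection \<open>A generator of constant bias\<close>

text \<open>An inner product added to \<open>h\<close>, in the form of the loop that computes it on
  stacks; missing bits of \<open>A\<close> count as zero.\<close>

fun dot_acc :: "bit list \<Rightarrow> bit list \<Rightarrow> bit \<Rightarrow> bit" where
  "dot_acc [] A h = h"
| "dot_acc (x # X) A h = dot_acc X (tl A) (if x = 1 \<and> A \<noteq> [] \<and> hd A = 1 then h + 1 else h)"

text \<open>Dropping one bit of \<open>A\<close> per round moves to the next row of a Toeplitz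
  matrix. The result is zero if no hash bit is one.\<close>

fun scan :: "bit list \<Rightarrow> bit list \<Rightarrow> bit list \<Rightarrow> bit list \<Rightarrow> bit" where
  "scan X A [] W = 0"
| "scan X A (b # B) W =
    (if dot_acc X A b = 1 then if W \<noteq> [] \<and> hd W = 1 then 1 else 0 else scan X (tl A) B (tl W))"

text \<open>
  Bit \<open>k\<close> of the hash of \<open>X\<close> is \<open>B\<^sub>k + (\<Sum>j. X\<^sub>j A\<^sub>k\<^sub>+\<^sub>j)\<close>: a Toeplitz matrix keeps the seed linear in the
  length of the hash and still makes the hash pairwise independent. The output \<open>scan X A B W\<close> is
  \<open>W\<^sub>k\<close> for the first \<open>k\<close> at which the hash is one.
\<close>

definition hash :: "bit list \<Rightarrow> bit list \<Rightarrow> bit list \<Rightarrow> nat \<Rightarrow> bit" where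
  "hash X A B k = dot_acc X (drop k A) (B ! k)"

definition hit :: "bit list \<Rightarrow> bit list \<Rightarrow> bit list \<Rightarrow> nat \<Rightarrow> bool" where
  "hit X A B k \<longleftrightarrow> (\<forall>i<k. hash X A B i = 0) \<and> hash X A B k = 1"

text \<open>Padding with zeros turns binary expansions of different lengths into vectors of a common
  length.\<close>

definition coef :: "bit list \<Rightarrow> nat \<Rightarrow> bit" where
  "coef X j = (if j < length X then X ! j else 0)"

lemma coef_Cons [simp]: "coef (x # X) 0 = x" "coef (x # X) (Suc j) = coef X j"
  by (simp_all add: coef_def)

lemma dot_acc_eq:
  "length X \<le> l \<Longrightarrow> l \<le> length A \<Longrightarrow> dot_acc X A h = h + (\<Sum>j<l. coef X j * A ! j)"
proof (induction X A h arbitrary: l rule: dot_acc.induct)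
  case (1 A h)
  then show ?case by (simp add: coef_def)
next
  case (2 x X A h)
  then obtain m where m: "l = Suc m" by (cases l) auto
  from 2 m obtain a A' where A: "A = a # A'" by (cases A) auto
  have "dot_acc X A' (h + x * a) = h + x * a + (\<Sum>j<m. coef X j * A' ! j)"
    using 2 m A by (cases x; cases a) auto
  moreover have "(if x = 1 \<and> A \<noteq> [] \<and> hd A = 1 then h + 1 else h) = h + x * a"
    using A by (cases x; cases a) auto
  ultimately show ?case
    unfolding m sum.lessThan_Suc_shift using A by (simp add: add.assoc)
qed

lemma hash_eq:
  assumes "length X \<le> l" "k + l \<le> length A"
  shows "hash X A B k = B ! k + (\<Sum>j<l. coef X j * A ! (k + j))"
  using assms dot_acc_eq[of X l "drop k A"] by (simp add: hash_def)

lemma hit_Suc: "hit X (a # A) (b # B) (Suc k) \<longleftrightarrow> dot_acc X (a # A) b = 0 \<and> hit X A B k"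
  by (auto simp: hit_def hash_def less_Suc_eq_0_disj)

text \<open>At most one position is hit, so the sum has at most one nonzero term; in this form the
  output is visibly linear in the table \<open>W\<close>.\<close>

lemma scan_eq:
  "length A = length W \<Longrightarrow> length B = length W \<Longrightarrow>
    scan X A B W = (\<Sum>k<length W. of_bool (hit X A B k) * W ! k)"
proof (induction W arbitrary: A B)
  case (Cons w W)
  then obtain a A' b B' where AB: "A = a # A'" "B = b # B'"
    by (metis length_Suc_conv length_Cons)
  have "hit X A B 0 \<longleftrightarrow> dot_acc X A b = 1"
    by (simp add: hit_def hash_def AB)
  with Cons show ?case
    unfolding length_Cons sum.lessThan_Suc_shift
    by (cases w; cases "dot_acc X A b") (auto simp: AB hit_Suc)
qed simp

lemma scan_flip:
  assumes "length A = length W" "length B = length W" "l < length W"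
  shows "scan X A B (flip l W) = scan X A B W + of_bool (hit X A B l)"
proof -
  have "scan X A B (flip l W) = (\<Sum>k<length W. of_bool (hit X A B k) * flip l W ! k)"
    using assms scan_eq[of A "flip l W" B X] by (simp only: length_flip)
  also have "\<dots> = (\<Sum>k<length W. of_bool (hit X A B k) * W ! k + (if k = l then of_bool (hit X A B l) else 0))"
    using assms by (intro sum.cong) (auto simp: nth_flip)
  also have "\<dots> = scan X A B W + of_bool (hit X A B l)"
    using assms by (simp add: scan_eq sum.distrib del: sum_of_bool_mult_eq)
  finally show ?thesis .
qed

text \<open>The constraints are triangular with pivots \<open>c k\<close>: flipping coordinate
  \<open>c k\<close> toggles the constraint \<open>k\<close> and keeps the earlier ones, so each
  further constraint halves the set of solutions.\<close>

lemma avg_constraints: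
  assumes "\<And>k x. k < m \<Longrightarrow> x \<in> cube n \<Longrightarrow> f k (flip (c k) x) = f k x + 1"
    and "\<And>k i x. k < m \<Longrightarrow> i < k \<Longrightarrow> x \<in> cube n \<Longrightarrow> f i (flip (c k) x) = f i x"
  shows "avg (cube n) (\<lambda>x. of_bool (\<forall>k<m. f k x = (0 :: bit))) = (1 / 2) ^ m"
  using assms
proof (induction m)
  case 0
  then show ?case by (simp add: avg_const)
next
  case (Suc m)
  let ?P = "\<lambda>x b. of_bool ((\<forall>k<m. f k x = 0) \<and> f m x = b) :: real"
  have "avg (cube n) (\<lambda>x. ?P x 0) = avg (cube n) (\<lambda>x. ?P (flip (c m) x) 0)"
    by (rule avg_flip[symmetric])
  also have "\<dots> = avg (cube n) (\<lambda>x. ?P x 1)"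
  proof (rule avg_cong)
    fix x assume x: "x \<in> cube n"
    have "f m x + 1 = 0 \<longleftrightarrow> f m x = 1" by (cases "f m x") auto
    with x Suc.prems show "?P (flip (c m) x) 0 = ?P x 1"
      by (simp add: less_Suc_eq)
  qed
  finally have "2 * avg (cube n) (\<lambda>x. ?P x 0) = avg (cube n) (\<lambda>x. ?P x 0 + ?P x 1)"
    by (simp add: avg_add)
  also have "\<dots> = avg (cube n) (\<lambda>x. of_bool (\<forall>k<m. f k x = 0))"
    by (rule avg_cong) (auto simp: of_bool_def)
  also have "\<dots> = (1 / 2) ^ m"
    using Suc by simp
  finally show ?case
    by (simp add: less_Suc_eq all_conj_distrib conj_commute)
qed

text \<open>For fixed \<open>A\<close>, the offsets in \<open>B\<close> alone make the hash bits
  independent and uniform.\<close>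

lemma avg_hit:
  assumes X: "length X \<le> l" and A: "k + l \<le> length A" and k: "k < n"
  shows "avg (cube n) (\<lambda>B. of_bool (hit X A B k)) = (1 / 2) ^ Suc k"
proof -
  \<comment> \<open>Complementing the bit at \<open>k\<close> turns a hit into the vanishing of
    \<open>f 0\<close>, ..., \<open>f k\<close>, the shape of
    \<open>avg_constraints\<close>.\<close>
  define f where "f i B = hash X A B i + of_bool (i = k)" for i B
  have "hit X A B k \<longleftrightarrow> (\<forall>i<Suc k. f i B = 0)" for B
    by (cases "hash X A B k") (auto simp: hit_def f_def less_Suc_eq)
  then have "avg (cube n) (\<lambda>B. of_bool (hit X A B k)) = avg (cube n) (\<lambda>B. of_bool (\<forall>i<Suc k. f i B = 0))"
    by simp
  also have "\<dots> = (1 / 2) ^ Suc k"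
  proof (rule avg_constraints[where c = "\<lambda>i. i"])
    show "f i (flip i B) = f i B + 1" if "i < Suc k" "B \<in> cube n" for i B
      using that assms by (simp add: f_def hash_eq[of X l] nth_flip add_ac)
    show "f i (flip j B) = f i B" if "j < Suc k" "i < j" "B \<in> cube n" for i j B
      using that assms by (simp add: f_def hash_eq[of X l] nth_flip)
  qed
  finally show ?thesis .
qed

lemma avg_hit_pair:
  assumes X: "length X \<le> l" "length Y \<le> l" and XY: "j < l" "coef X j \<noteq> coef Y j"
    and k: "k + l \<le> n"
  shows "avg (cube n) (\<lambda>A. avg (cube n) (\<lambda>B. of_bool (hit X A B k \<and> hit Y A B k))) \<le> ((1 / 2) ^ Suc k)\<^sup>2"
proof -
  define c where "c j = coef X j + coef Y j" for j
  define D where "D i A = (\<Sum>j<l. c j * A ! (i + j))" for i A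
  \<comment> \<open>The last position at which the padded \<open>X\<close> and \<open>Y\<close>
    differ. The last coordinate on which \<open>D i\<close> depends is therefore
    \<open>i + J\<close>, and these coordinates are the pivots of a triangular system.\<close>
  define J where "J = Max {j. j < l \<and> c j = 1}"
  have fin: "finite {j. j < l \<and> c j = 1}" by simp
  have "c j = 1" using XY by (cases "coef X j"; cases "coef Y j") (auto simp: c_def)
  then have "J \<in> {j. j < l \<and> c j = 1}"
    unfolding J_def using XY by (intro Max_in) auto
  then have J: "J < l" "c J = 1" by auto
  have J_max: "c j = 0" if "j < l" "J < j" for j
    using Max_ge[OF fin, of j] that by (cases "c j") (auto simp: J_def[symmetric])
  have "k < n" using k XY by simp
  have D0: "D i A = 0" if "hash X A B i = hash Y A B i" "i \<le> k" "A \<in> cube n" for A B i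
  proof -
    have "0 = hash X A B i + hash Y A B i" using that by simp
    also have "\<dots> = (\<Sum>j<l. coef X j * A ! (i + j)) + (\<Sum>j<l. coef Y j * A ! (i + j))"
      using that X k by (simp add: hash_eq[of _ l] add_ac)
    also have "\<dots> = D i A"
      by (simp add: D_def c_def distrib_right sum.distrib)
    finally show ?thesis by simp
  qed
  have D_flip: "D m (flip (i + J) A) = D m A + (if i = m then 1 else 0)"
    if i: "i < Suc k" and m: "m \<le> i" and A: "A \<in> cube n" for i m A
  proof -
    have "D m (flip (i + J) A) = (\<Sum>j<l. c j * A ! (m + j) + (if j = i + J - m then c j else 0))"
      unfolding D_def using i m A J k
      by (intro sum.cong) (auto simp: nth_flip distrib_left)
    also have "\<dots> = D m A + (if i = m then 1 else 0)"
      using J J_max[of "i + J - m"] m by (auto simp: D_def sum.distrib)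
    finally show ?thesis .
  qed
  \<comment> \<open>A common hit makes all the hash differences \<open>D i\<close> vanish, a
    condition on \<open>A\<close> alone, while a hit of \<open>X\<close> has conditional probability
    \<open>(1 / 2) ^ Suc k\<close> over \<open>B\<close>. The two factors thus come from independent
    parts of the seed.\<close>
  have "avg (cube n) (\<lambda>A. avg (cube n) (\<lambda>B. of_bool (hit X A B k \<and> hit Y A B k))) \<le>
      avg (cube n) (\<lambda>A. avg (cube n) (\<lambda>B. of_bool (\<forall>i<Suc k. D i A = 0) * of_bool (hit X A B k)))"
  proof (intro avg_mono)
    fix A B assume A: "A \<in> cube n"
    show "of_bool (hit X A B k \<and> hit Y A B k) \<le> of_bool (\<forall>i<Suc k. D i A = 0) * (of_bool (hit X A B k) :: real)"
    proof (cases "hit X A B k \<and> hit Y A B k")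
      case True
      then have "hash X A B i = hash Y A B i" if "i < Suc k" for i
        using that by (auto simp: hit_def less_Suc_eq)
      then have "\<forall>i<Suc k. D i A = 0"
        using D0[of A B] A by (metis less_Suc_eq_le)
      with True show ?thesis by simp
    qed auto
  qed
  also have "\<dots> = avg (cube n) (\<lambda>A. of_bool (\<forall>i<Suc k. D i A = 0) * (1 / 2) ^ Suc k)"
    by (intro avg_cong) (use X k \<open>k < n\<close> in \<open>simp only: avg_cmult avg_hit[of X l] mem_cube\<close>)
  also have "\<dots> = (1 / 2) ^ Suc k * (1 / 2) ^ Suc k"
    unfolding avg_multc
  proof (subst avg_constraints[where c = "\<lambda>i. i + J"])
    show "D i (flip (i + J) A) = D i A + 1" if "i < Suc k" "A \<in> cube n" for i A
      using D_flip[of i i A] that by simp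
    show "D m (flip (i + J) A) = D m A" if "i < Suc k" "m < i" "A \<in> cube n" for i m A
      using D_flip[of i m A] that by simp
  qed simp
  finally show ?thesis by (simp only: power2_eq_square)
qed

lemma of_nat_bit: "(of_nat N :: bit) = of_bool (odd N)"
  by (induction N) auto

text \<open>
  At the position \<open>k\<close> with \<open>2\<^sup>k \<approx> card S\<close>, the number of elements of \<open>S\<close> first hit there is odd
  with probability at least \<open>3/16\<close>, by \<open>1[N odd] \<ge> 2N - N\<^sup>2\<close> and pairwise independence; then the
  table entry \<open>W\<^sub>k\<close> makes the parity unbiased.
\<close>

theorem scan_bias:
  assumes S: "finite S" "S \<noteq> {}" "card S \<le> 2 ^ l"
    and len: "\<And>i. i \<in> S \<Longrightarrow> length (X i) \<le> l" and l: "1 \<le> l"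
    and inj: "\<And>i i'. i \<in> S \<Longrightarrow> i' \<in> S \<Longrightarrow> i \<noteq> i' \<Longrightarrow> \<exists>j<l. coef (X i) j \<noteq> coef (X i') j"
  shows "\<bar>avg (cube (2 * l)) (\<lambda>A. avg (cube (2 * l)) (\<lambda>B. avg (cube (2 * l))
    (\<lambda>W. sign (\<Sum>i\<in>S. scan (X i) A B W))))\<bar> \<le> 13 / 16"
proof -
  \<comment> \<open>Minimality gives \<open>2 ^ k \<le> 2 * card S\<close>, which places the
    expected number of hits, \<open>card S / 2 ^ (k + 1)\<close>, between 1/4 and 1/2.\<close>
  define k where "k = (LEAST k. card S \<le> 2 ^ k)"
  have k1: "card S \<le> 2 ^ k" unfolding k_def by (rule LeastI[of _ l]) (rule S(3))
  have k2: "k \<le> l" unfolding k_def by (rule Least_le) (rule S(3))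
  have k3: "2 ^ k \<le> 2 * card S"
  proof (cases k)
    case 0
    then show ?thesis using S by (simp add: Suc_leI card_gt_0_iff)
  next
    case (Suc m)
    then have "\<not> card S \<le> 2 ^ m" unfolding k_def by (intro not_less_Least) (simp add: k_def[symmetric])
    with Suc show ?thesis by simp
  qed
  \<comment> \<open>Row \<open>k \<le> l\<close> of the Toeplitz matrix with \<open>l\<close>
    columns reads entries of \<open>A\<close> below \<open>k + l\<close>, hence the length
    \<open>2 * l\<close>.\<close>
  let ?n = "2 * l"
  let ?C = "cube ?n"
  define p :: real where "p = (1 / 2) ^ Suc k"
  define \<mu> where "\<mu> = card S * p"
  have \<mu>: "1 / 4 \<le> \<mu>" "\<mu> \<le> 1 / 2"
  proof -
    have "real (card S) \<le> 2 ^ k" using k1 by (metis of_nat_le_iff of_nat_numeral of_nat_power)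
    moreover have "2 ^ k \<le> 2 * real (card S)" using k3 by (metis of_nat_le_iff of_nat_numeral of_nat_power of_nat_mult)
    ultimately show "1 / 4 \<le> \<mu>" "\<mu> \<le> 1 / 2"
      by (simp_all add: \<mu>_def p_def field_simps)
  qed
  define N where "N A B = (\<Sum>i\<in>S. of_bool (hit (X i) A B k) :: nat)" for A B
  have EN: "avg ?C (\<lambda>A. avg ?C (\<lambda>B. real (N A B))) = \<mu>"
  proof -
    have "avg ?C (\<lambda>A. avg ?C (\<lambda>B. real (N A B))) = avg ?C (\<lambda>A. \<Sum>i\<in>S. p)"
      unfolding N_def of_nat_sum avg_sum of_nat_of_bool p_def
      by (intro avg_cong sum.cong avg_hit[of _ l]) (use len k2 l in auto)
    then show ?thesis by (simp add: avg_const \<mu>_def)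
  qed
  have EN2: "avg ?C (\<lambda>A. avg ?C (\<lambda>B. (real (N A B))\<^sup>2)) \<le> \<mu> + \<mu>\<^sup>2"
  proof -
    have "avg ?C (\<lambda>A. avg ?C (\<lambda>B. (real (N A B))\<^sup>2)) =
        (\<Sum>i\<in>S. \<Sum>i'\<in>S. avg ?C (\<lambda>A. avg ?C (\<lambda>B. of_bool (hit (X i) A B k \<and> hit (X i') A B k))))"
      by (simp add: N_def power2_eq_square sum_product avg_sum of_bool_conj del: mem_cube)
    \<comment> \<open>Distinct elements contribute \<open>p\<^sup>2\<close> by pairwise
      independence; the diagonal contributes \<open>p\<close>, and is given an extra
      \<open>p\<^sup>2\<close> to make the double sum uniform.\<close>
    also have "\<dots> \<le> (\<Sum>i\<in>S. \<Sum>i'\<in>S. (if i = i' then p else 0) + p\<^sup>2)"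
    proof (intro sum_mono)
      fix i i' assume i: "i \<in> S" "i' \<in> S"
      show "avg ?C (\<lambda>A. avg ?C (\<lambda>B. of_bool (hit (X i) A B k \<and> hit (X i') A B k))) \<le> (if i = i' then p else 0) + p\<^sup>2"
      proof (cases "i = i'")
        case True
        have "avg ?C (\<lambda>A. avg ?C (\<lambda>B. of_bool (hit (X i) A B k))) = avg ?C (\<lambda>A. p)"
          unfolding p_def by (intro avg_cong avg_hit[of _ l]) (use i len k2 l in auto)
        with True show ?thesis by (simp add: avg_const)
      next
        case False
        with inj i obtain j where "j < l" "coef (X i) j \<noteq> coef (X i') j" by blast
        with False show ?thesis
          using avg_hit_pair[of "X i" l "X i'" j k ?n] len i k2 by (simp add: p_def)
      qed
    qed
    also have "\<dots> = \<mu> + \<mu>\<^sup>2"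
      using S by (simp add: sum.distrib \<mu>_def power2_eq_square algebra_simps)
    finally show ?thesis .
  qed
  have inner: "\<bar>avg ?C (\<lambda>W. sign (\<Sum>i\<in>S. scan (X i) A B W))\<bar> \<le> 1 - (2 * real (N A B) - (real (N A B))\<^sup>2)"
    if AB: "A \<in> ?C" "B \<in> ?C" for A B
  proof (cases "odd (N A B)")
    case True
    have "avg ?C (\<lambda>W. sign (\<Sum>i\<in>S. scan (X i) A B W)) = 0"
    proof (rule avg_sign_flip[where i = k])
      fix W assume W: "W \<in> ?C"
      have "(\<Sum>i\<in>S. of_bool (hit (X i) A B k)) = (of_nat (N A B) :: bit)"
        by (simp add: N_def)
      with True have "(\<Sum>i\<in>S. of_bool (hit (X i) A B k)) = (1 :: bit)"
        by (simp add: of_nat_bit)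
      then show "(\<Sum>i\<in>S. scan (X i) A B (flip k W)) = (\<Sum>i\<in>S. scan (X i) A B W) + 1"
        using W AB k2 l by (simp add: scan_flip sum.distrib)
    qed
    moreover have "0 \<le> (real (N A B) - 1)\<^sup>2" by simp
    ultimately show ?thesis by (simp add: power2_diff)
  next
    case False
    \<comment> \<open>An even number is zero or at least two, so \<open>2 * N - N\<^sup>2\<close> is
      not positive and the trivial bound one suffices.\<close>
    then obtain m where "N A B = 2 * m" by auto
    then have "2 * N A B \<le> N A B * N A B" by (cases m) auto
    from of_nat_mono[OF this, where 'a = real] have "2 * real (N A B) \<le> (real (N A B))\<^sup>2"
      by (simp add: power2_eq_square)
    then show ?thesis using avg_sign_le_1[of ?C "\<lambda>W. \<Sum>i\<in>S. scan (X i) A B W"] by simp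
  qed
  have "\<bar>avg ?C (\<lambda>A. avg ?C (\<lambda>B. avg ?C (\<lambda>W. sign (\<Sum>i\<in>S. scan (X i) A B W))))\<bar> \<le>
      avg ?C (\<lambda>A. \<bar>avg ?C (\<lambda>B. avg ?C (\<lambda>W. sign (\<Sum>i\<in>S. scan (X i) A B W)))\<bar>)"
    by (rule abs_avg_le)
  also have "\<dots> \<le> avg ?C (\<lambda>A. avg ?C (\<lambda>B. \<bar>avg ?C (\<lambda>W. sign (\<Sum>i\<in>S. scan (X i) A B W))\<bar>))"
    by (intro avg_mono abs_avg_le)
  also have "\<dots> \<le> avg ?C (\<lambda>A. avg ?C (\<lambda>B. 1 - (2 * real (N A B) - (real (N A B))\<^sup>2)))"
    by (intro avg_mono inner)
  also have "\<dots> = 1 - (2 * \<mu> - avg ?C (\<lambda>A. avg ?C (\<lambda>B. (real (N A B))\<^sup>2)))"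
    by (simp only: avg_diff avg_cmult EN avg_const finite_cube cube_nonempty not_False_eq_True)
  also have "\<dots> \<le> 1 - (\<mu> - \<mu>\<^sup>2)" using EN2 by simp
  \<comment> \<open>The product of \<open>\<mu> - 1 / 4\<close> and \<open>3 / 4 - \<mu>\<close>
    equals \<open>\<mu> - \<mu>\<^sup>2 - 3 / 16\<close>; the constant 3/16 is the value of
    \<open>\<mu> - \<mu>\<^sup>2\<close> at 1/4.\<close>
  also have "\<dots> \<le> 13 / 16"
    using mult_nonneg_nonneg[of "\<mu> - 1 / 4" "3 / 4 - \<mu>"] \<mu> by (simp add: power2_eq_square field_simps)
  finally show ?thesis .
qed

subsection \<open>Binary expansions as indices\<close>

fun inc :: "bit list \<Rightarrow> bit list" where
  "inc [] = [1]"
| "inc (b # x) = (if b = 1 then 0 # inc x else 1 # x)"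

text \<open>The least significant bit comes first. Iterated increment is what the program does to
  its counter, so its contents are \<open>bin i\<close> by construction.\<close>

definition bin :: "nat \<Rightarrow> bit list" where
  "bin n = (inc ^^ n) []"

definition blen :: "nat \<Rightarrow> nat" where
  "blen n = length (bin n)"

fun val :: "bit list \<Rightarrow> nat" where
  "val [] = 0"
| "val (b # x) = (if b = 1 then 1 else 0) + 2 * val x"

lemma bin_0 [simp]: "bin 0 = []" and bin_Suc: "bin (Suc n) = inc (bin n)"
  by (simp_all add: bin_def)

lemma val_inc: "val (inc x) = Suc (val x)"
  by (induction x) auto

lemma val_bin: "val (bin n) = n"
  by (induction n) (auto simp: bin_Suc val_inc)

lemma inc_nonempty: "inc x \<noteq> []"
  by (cases x) auto

lemma last_inc: "x = [] \<or> last x = 1 \<Longrightarrow> last (inc x) = 1"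
  by (induction x) (auto simp: inc_nonempty split: if_splits)

lemma bin_last: "bin n = [] \<or> last (bin n) = 1"
  by (induction n) (auto simp: bin_Suc last_inc)

lemma val_less: "val x < 2 ^ length x"
  by (induction x) auto

lemma val_ge: "x \<noteq> [] \<Longrightarrow> last x = 1 \<Longrightarrow> 2 ^ length x \<le> 2 * val x"
  by (induction x) (auto split: if_splits)

lemma less_blen: "n < 2 ^ blen n"
  using val_less[of "bin n"] by (simp add: blen_def val_bin)

lemma blen_le: "n \<ge> 1 \<Longrightarrow> 2 ^ blen n \<le> 2 * n"
  using val_ge[of "bin n"] bin_last[of n] val_bin[of n] by (cases "bin n = []") (auto simp: blen_def)

lemma blen_mono:
  assumes "i \<le> n"
  shows "blen i \<le> blen n"
proof (cases "i = 0")
  case False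
  have "2 ^ blen i \<le> 2 * i" using False by (intro blen_le) auto
  also have "\<dots> < 2 ^ Suc (blen n)" using assms less_blen[of n] by simp
  finally have "blen i < Suc (blen n)" by (rule power_less_imp_less_exp[rotated]) simp
  then show ?thesis by simp
qed (simp add: blen_def)

lemma blen_pos: "n \<ge> 1 \<Longrightarrow> 1 \<le> blen n"
  using blen_mono[of 1 n] by (simp add: blen_def bin_def)

lemma blen_le_self: "blen n \<le> n"
proof (cases "n = 0")
  case False
  show ?thesis
  proof (rule ccontr)
    assume "\<not> blen n \<le> n"
    then have "2 ^ Suc n \<le> (2::nat) ^ blen n" by (intro power_increasing) auto
    also have "\<dots> \<le> 2 * n" using False by (intro blen_le) auto
    finally show False using less_exp[of n] by simp
  qed
qed (simp add: blen_def)

lemma coef_Nil [simp]: "coef [] j = 0"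
  by (simp add: coef_def)

lemma val_cong: "(\<And>j. coef x j = coef y j) \<Longrightarrow> val x = val y"
proof (induction x arbitrary: y)
  case Nil
  have "coef y j = 0" for j using Nil[of j] by simp
  then show ?case
  proof (induction y)
    case (Cons b y)
    show ?case using Cons.IH Cons.prems[of 0] Cons.prems[of "Suc j" for j] by auto
  qed simp
next
  case (Cons b x)
  show ?case
  proof (cases y)
    case Nil
    have "coef x j = coef [] j" for j using Cons.prems[of "Suc j"] Nil by simp
    then show ?thesis using Cons.IH[of "[]"] Cons.prems[of 0] Nil by simp
  next
    case (Cons c y')
    have "coef x j = coef y' j" for j using Cons.prems[of "Suc j"] Cons by simp
    then show ?thesis using Cons.IH[of y'] Cons.prems[of 0] Cons by simp
  qed
qed

text \<open>The value of an expansion depends only on its padded coefficients, so different numbers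
  stay different after padding.\<close>

lemma bin_coef_neq:
  assumes "i \<noteq> i'" "blen i \<le> l" "blen i' \<le> l"
  shows "\<exists>j<l. coef (bin i) j \<noteq> coef (bin i') j"
proof (rule ccontr)
  assume *: "\<not> (\<exists>j<l. coef (bin i) j \<noteq> coef (bin i') j)"
  have "coef (bin i) j = coef (bin i') j" for j
    using * assms(2,3) by (cases "j < l") (auto simp: coef_def blen_def)
  then have "val (bin i) = val (bin i')" by (rule val_cong)
  with assms(1) show False by (simp add: val_bin)
qed

subsection \<open>Sums of independent copies\<close>

text \<open>The reversals record that a stack program moves each part of the block from one stack to
  another. Reversal permutes the cube, so the distribution is unaffected.\<close>

definition chunk_bit :: "nat \<Rightarrow> bit list \<Rightarrow> bit list \<Rightarrow> bit" where
  "chunk_bit L X u =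
    scan X (rev (take L u)) (rev (take L (drop L u))) (rev (take L (drop (L + L) u)))"

fun chunks :: "nat \<Rightarrow> bit list \<Rightarrow> nat \<Rightarrow> bit list \<Rightarrow> bit" where
  "chunks L X 0 u = 0"
| "chunks L X (Suc D) u = chunk_bit L X u + chunks L X D (drop (3 * L) u)"

text \<open>Output \<open>i\<close> has index \<open>i + 1\<close>, since the counter is incremented
  before use; the indices are 1 to \<open>n\<close> and fit into \<open>blen n\<close> bits.\<close>

definition out :: "nat \<Rightarrow> nat \<Rightarrow> nat \<Rightarrow> bit list \<Rightarrow> bit list" where
  "out n L D u = map (\<lambda>i. chunks L (bin (Suc i)) D u) [0..<n]"

lemma chunks_add:
  "length u = a * (3 * L) \<Longrightarrow> chunks L X (a + b) (u @ v) = chunks L X a u + chunks L X b v"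
proof (induction a arbitrary: u)
  case (Suc a)
  then have "chunk_bit L X (u @ v) = chunk_bit L X u"
    by (simp add: chunk_bit_def)
  with Suc show ?case by (simp add: add.assoc)
qed simp

text \<open>Concatenating seeds adds outputs. The sum of generators in Viola's theorem is therefore
  the same generator with a longer seed.\<close>

lemma out_add:
  "length u = a * (3 * L) \<Longrightarrow> out n L (a + b) (u @ v) = vadd (out n L a u) (out n L b v)"
  by (intro nth_equalityI) (auto simp: out_def chunks_add)

lemma avg_rev: "avg (cube n) (\<lambda>x. f (rev x)) = avg (cube n) f"
proof -
  have "bij_betw rev (cube n) (cube n)"
    by (rule bij_betw_byWitness[where f' = rev]) auto
  then show ?thesis by (rule avg_reindex[symmetric])
qed

lemma chunk_bias:
  assumes S: "S \<noteq> {}" "S \<subseteq> {..<n}"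
  shows "\<bar>avg (cube (3 * (2 * blen n))) (\<lambda>u. sign (\<Sum>i\<in>S. chunk_bit (2 * blen n) (bin (Suc i)) u))\<bar> \<le> 13 / 16"
proof -
  define L where "L = 2 * blen n"
  have n: "n \<ge> 1" using S by (cases n) auto
  define F where "F A B W = sign (\<Sum>i\<in>S. scan (bin (Suc i)) A B W)" for A B W
  have "avg (cube (3 * L)) (\<lambda>u. sign (\<Sum>i\<in>S. chunk_bit L (bin (Suc i)) u)) =
      avg (cube (L + (L + L))) (\<lambda>u. F (rev (take L u)) (rev (take L (drop L u))) (rev (take L (drop (L + L) u))))"
    by (simp add: F_def chunk_bit_def numeral_3_eq_3 add.assoc)
  also have "\<dots> = avg (cube L) (\<lambda>x. avg (cube L) (\<lambda>y. avg (cube L) (\<lambda>z. F (rev x) (rev y) (rev z))))"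
    unfolding avg_cube_add by (intro avg_cong) simp
  also have "\<dots> = avg (cube L) (\<lambda>x. avg (cube L) (\<lambda>y. avg (cube L) (\<lambda>z. F x y z)))"
    unfolding avg_rev[of L "F _ _"] avg_rev[of L "\<lambda>y. avg (cube L) (F _ y)"]
      avg_rev[of L "\<lambda>x. avg (cube L) (\<lambda>y. avg (cube L) (F x y))"] ..
  also have "\<bar>\<dots>\<bar> \<le> 13 / 16"
    unfolding F_def L_def
  proof (rule scan_bias)
    show "finite S" "S \<noteq> {}" using S finite_subset by auto
    have "card S \<le> n" using card_mono[OF _ S(2)] by simp
    with less_blen[of n] show "card S \<le> 2 ^ blen n" by simp
    show "1 \<le> blen n" using n by (rule blen_pos)
    have *: "blen (Suc i) \<le> blen n" if "i \<in> S" for i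
      using that S by (intro blen_mono) auto
    then show "length (bin (Suc i)) \<le> blen n" if "i \<in> S" for i
      using that by (simp add: blen_def)
    show "\<exists>j<blen n. coef (bin (Suc i)) j \<noteq> coef (bin (Suc i')) j"
      if "i \<in> S" "i' \<in> S" "i \<noteq> i'" for i i'
      using that * by (intro bin_coef_neq) auto
  qed
  finally show ?thesis by (simp only: L_def)
qed

text \<open>Signs turn the sum over independent blocks into a product, so the biases
  multiply.\<close>

lemma chunks_bias:
  assumes S: "S \<noteq> {}" "S \<subseteq> {..<n}"
  shows "\<bar>avg (cube (t * (3 * (2 * blen n)))) (\<lambda>u. sign (\<Sum>i\<in>S. chunks (2 * blen n) (bin (Suc i)) t u))\<bar> \<le> (13 / 16) ^ t"
proof (induction t)
  case 0
  then show ?case by (simp add: avg_const)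
next
  case (Suc t)
  define L where "L = 2 * blen n"
  let ?b = "avg (cube (3 * L)) (\<lambda>u. sign (\<Sum>i\<in>S. chunk_bit L (bin (Suc i)) u))"
  let ?c = "avg (cube (t * (3 * L))) (\<lambda>u. sign (\<Sum>i\<in>S. chunks L (bin (Suc i)) t u))"
  have "avg (cube (Suc t * (3 * L))) (\<lambda>u. sign (\<Sum>i\<in>S. chunks L (bin (Suc i)) (Suc t) u)) = ?b * ?c"
    unfolding mult_Suc avg_cube_add avg_mult_avg
    by (intro avg_cong) (simp add: chunk_bit_def sum.distrib sign_add)
  also have "\<bar>\<dots>\<bar> \<le> 13 / 16 * (13 / 16) ^ t"
    unfolding abs_mult using chunk_bias[OF S] Suc by (intro mult_mono) (auto simp: L_def)
  finally show ?case by (simp add: L_def)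
qed

lemma out_small_bias:
  "small_bias n ((13 / 16) ^ t) (cube (t * (3 * (2 * blen n)))) (out n (2 * blen n) t)"
  unfolding small_bias_def
proof (intro conjI ballI impI)
  fix a assume a: "a \<in> cube n" "a \<noteq> replicate n 0"
  define S where "S = {i. i < n \<and> a ! i = 1}"
  have "S \<noteq> {}" "S \<subseteq> {..<n}"
    using a by (auto simp: S_def list_eq_iff_nth_eq)
  moreover have "dot a (out n L t u) = (\<Sum>i\<in>S. chunks L (bin (Suc i)) t u)" for L u
  proof -
    have "dot a (out n L t u) = (\<Sum>i<n. if a ! i = 1 then chunks L (bin (Suc i)) t u else 0)"
      using a by (auto simp: dot_def out_def intro!: sum.cong)
    also have "\<dots> = (\<Sum>i\<in>S. chunks L (bin (Suc i)) t u)"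
      by (simp add: S_def sum.If_cases Int_def)
    finally show ?thesis .
  qed
  ultimately show "\<bar>avg (cube (t * (3 * (2 * blen n)))) (\<lambda>u. sign (dot a (out n (2 * blen n) t u)))\<bar> \<le> (13 / 16) ^ t"
    using chunks_bias by simp
qed (simp add: out_def)

section \<open>Iterating Viola's step on seed strings\<close>

lemma fools_reindex:
  assumes f: "fools n d e A y" and h: "bij_betw h A B" and y: "\<And>u. u \<in> A \<Longrightarrow> y' (h u) = y u"
  shows "fools n d e B y'"
proof -
  have "avg B (\<lambda>u. sign (p (y' u))) = avg A (\<lambda>u. sign (p (y u)))" for p
    unfolding avg_reindex[OF h] by (intro avg_cong) (simp add: y)
  moreover have "\<forall>u\<in>B. y' u \<in> cube n"
    using f y bij_betw_imp_surj_on[OF h] by (auto simp: fools_def)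
  ultimately show ?thesis using f by (simp add: fools_def)
qed

text \<open>The number 16 is the fixed point of e \<mapsto> 4 \<surd>e. Written as 16 times a power
  of \<eta>, the error passes through a step by halving the exponent, and the last of
  \<open>d\<close> steps ends at \<open>16 * \<eta>\<close>.\<close>

lemma out_fools:
  fixes \<eta> :: real
  assumes \<eta>: "0 \<le> \<eta>" "\<eta> \<le> 1" "(13 / 16) ^ t \<le> \<eta> ^ 2 ^ d" and j: "j \<le> d"
  shows "fools n j (16 * \<eta> ^ 2 ^ (d - j)) (cube (j * t * (3 * (2 * blen n)))) (out n (2 * blen n) (j * t))"
  using j
proof (induction j)
  case 0
  then show ?case using \<eta> by (intro fools_0) (auto simp: out_def)
next
  case (Suc j)
  define L where "L = 2 * blen n"
  define m where "m = 3 * L"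
  let ?\<delta> = "(13 / 16) ^ t :: real"
  have d: "d - j = Suc (d - Suc j)" using Suc.prems by simp
  have "fools n (Suc j) (16 * \<eta> ^ 2 ^ (d - Suc j)) (cube (j * t * m) \<times> cube (t * m))
      (\<lambda>(u, v). vadd (out n L (j * t) u) (out n L t v))"
  proof (rule fools_Suc)
    show "fools n j (16 * \<eta> ^ 2 ^ (d - j)) (cube (j * t * m)) (out n L (j * t))"
      using Suc by (simp add: m_def L_def)
    show "small_bias n ?\<delta> (cube (t * m)) (out n L t)"
      unfolding m_def L_def by (rule out_small_bias)
    have "?\<delta>\<^sup>2 \<le> ?\<delta>" by (simp add: power2_eq_square mult_left_le power_le_one)
    also have "\<dots> \<le> \<eta> ^ 2 ^ d" by (rule \<eta>)
    also have "\<dots> \<le> \<eta> ^ 2 ^ (d - j)" by (rule power_decreasing) (use \<eta> in auto)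
    also have "\<dots> \<le> 16 * \<eta> ^ 2 ^ (d - j)" using \<eta> by simp
    finally show "?\<delta>\<^sup>2 \<le> 16 * \<eta> ^ 2 ^ (d - j)" .
    show "16 * (16 * \<eta> ^ 2 ^ (d - j)) \<le> (16 * \<eta> ^ 2 ^ (d - Suc j))\<^sup>2"
      unfolding d by (simp add: power_mult_distrib power_mult[symmetric] mult.commute)
  qed (use \<eta> in auto)
  then show ?case
    unfolding L_def[symmetric] m_def[symmetric]
  proof (rule fools_reindex)
    show "bij_betw (\<lambda>(u, v). u @ v) (cube (j * t * m) \<times> cube (t * m)) (cube (Suc j * t * m))"
      by (rule bij_betw_byWitness[where f' = "\<lambda>u. (take (j * t * m) u, drop (j * t * m) u)"])
         (auto simp: algebra_simps)
    fix u :: "bit list \<times> bit list" assume "u \<in> cube (j * t * m) \<times> cube (t * m)"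
    then show "out n L (Suc j * t) (case u of (u, v) \<Rightarrow> u @ v) = (case u of (u, v) \<Rightarrow> vadd (out n L (j * t) u) (out n L t v))"
      using out_add[of "fst u" "j * t" L n t "snd u"] by (auto simp: m_def L_def add.commute)
  qed
qed

subsection \<open>Error and seed length\<close>

text \<open>Each of the \<open>d\<close> summands gets \<open>16 * k * 2 ^ d\<close> blocks. As
  (13/16)^4 is below 1/2, its bias is at most \<open>(1 / 2) ^ (4 * k * 2 ^ d)\<close>, and
  \<open>4 * k \<ge> k + 3\<close> for positive \<open>k\<close> meets the demand of
  \<open>gen_fools\<close>.\<close>

definition copies :: "nat \<Rightarrow> nat \<Rightarrow> nat" where
  "copies d k = d * (16 * k * 2 ^ d)"

definition seed_len :: "nat \<Rightarrow> nat \<Rightarrow> nat \<Rightarrow> nat" where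
  "seed_len n d k = copies d k * (3 * (2 * blen n))"

definition gen :: "nat \<Rightarrow> nat \<Rightarrow> nat \<Rightarrow> bit list \<Rightarrow> bit list" where
  "gen n d k = out n (2 * blen n) (copies d k)"

lemma precision_bound:
  assumes "\<epsilon> > 0"
  shows "2 / 2 ^ precision \<epsilon> \<le> \<epsilon>"
proof -
  have "log 2 (2 / \<epsilon>) \<le> real (precision \<epsilon>)"
    unfolding precision_def by linarith
  then have "2 / \<epsilon> \<le> 2 powr real (precision \<epsilon>)"
    using assms by (simp add: log_le_iff)
  then show ?thesis using assms by (simp add: powr_realpow field_simps)
qed

lemma precision_pos_imp:
  assumes "\<epsilon> > 0" "precision \<epsilon> \<ge> 1"
  shows "real (precision \<epsilon>) \<le> 2 + log 2 (1 / \<epsilon>)" "\<epsilon> < 2"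
proof -
  have "1 \<le> nat z \<Longrightarrow> 1 \<le> z" for z by arith
  then have "1 \<le> \<lceil>log 2 (2 / \<epsilon>)\<rceil>"
    using assms(2) unfolding precision_def by blast
  then have pos: "0 < log 2 (2 / \<epsilon>)" and "real (precision \<epsilon>) = real_of_int \<lceil>log 2 (2 / \<epsilon>)\<rceil>"
    by (linarith, simp add: precision_def)
  then have "real (precision \<epsilon>) < log 2 (2 / \<epsilon>) + 1"
    by linarith
  also have "log 2 (2 / \<epsilon>) = 1 + log 2 (1 / \<epsilon>)"
    using assms by (simp add: log_divide)
  finally show "real (precision \<epsilon>) \<le> 2 + log 2 (1 / \<epsilon>)" by simp
  show "\<epsilon> < 2"
    using pos assms by (simp add: zero_less_log_cancel_iff)
qed

lemma gen_fools:
  assumes k: "k \<ge> 1"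
  shows "fools n d (2 / 2 ^ k) (cube (seed_len n d k)) (gen n d k)"
proof -
  \<comment> \<open>Chosen so that the final error \<open>16 * \<eta>\<close> is
    \<open>2 / 2 ^ k\<close>.\<close>
  define \<eta> :: real where "\<eta> = (1 / 2) ^ (k + 3)"
  define t where "t = 16 * k * 2 ^ d"
  have "(13 / 16 :: real) ^ t = ((13 / 16) ^ 4) ^ (4 * k * 2 ^ d)"
    unfolding t_def power_mult[symmetric] by (simp only: mult.assoc[symmetric]) simp
  also have "\<dots> \<le> (1 / 2) ^ (4 * k * 2 ^ d)"
    by (intro power_mono) (auto simp: power4_eq_xxxx)
  also have "\<dots> \<le> (1 / 2) ^ ((k + 3) * 2 ^ d)"
    using k by (intro power_decreasing mult_right_mono) auto
  also have "\<dots> = \<eta> ^ 2 ^ d"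
    by (simp only: \<eta>_def power_mult)
  finally have "(13 / 16 :: real) ^ t \<le> \<eta> ^ 2 ^ d" .
  from out_fools[OF _ _ this, of d n]
  have "fools n d (16 * \<eta>) (cube (d * t * (3 * (2 * blen n)))) (out n (2 * blen n) (d * t))"
    by (simp add: \<eta>_def power_le_one)
  then show ?thesis
    by (simp add: seed_len_def gen_def[abs_def] copies_def t_def \<eta>_def power_add field_simps)
qed

lemma expectation_uniform: "measure_pmf.expectation (map_pmf G (uniform s)) f = avg (cube s) (\<lambda>u. f (G u))"
  by (simp add: uniform_def integral_pmf_of_set avg_def del: mem_cube)

theorem gen_is_prg:
  assumes \<epsilon>: "\<epsilon> > 0"
  shows "is_prg (f2_polys d n) n \<epsilon> (map_pmf (gen n d (precision \<epsilon>)) (uniform (seed_len n d (precision \<epsilon>))))"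
  unfolding is_prg_def
proof (intro conjI ballI)
  let ?k = "precision \<epsilon>"
  show "set_pmf (map_pmf (gen n d ?k) (uniform (seed_len n d ?k))) \<subseteq> cube n"
    by (auto simp: gen_def out_def)
  fix f assume "f \<in> f2_polys d n"
  then obtain p where f: "f = (\<lambda>x. sign (eval_poly p x))" and p: "deg_le n d (eval_poly p)"
    by (auto simp: f2_polys_def intro: deg_le_eval_poly)
  have U: "measure_pmf.expectation (uniform n) f = avg (cube n) f"
    using expectation_uniform[of "\<lambda>u. u" n f] by simp
  have "\<bar>avg (cube (seed_len n d ?k)) (\<lambda>u. f (gen n d ?k u)) - avg (cube n) f\<bar> \<le> 2 / 2 ^ ?k"
  proof (cases "?k = 0")
    \<comment> \<open>With \<open>k = 0\<close> the seed is empty and the required error is 2, the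
      trivial bound.\<close>
    case True
    have "\<bar>avg (cube (seed_len n d ?k)) (\<lambda>u. f (gen n d ?k u))\<bar> \<le> 1" "\<bar>avg (cube n) f\<bar> \<le> 1"
      unfolding f by (intro avg_sign_le_1; simp)+
    then show ?thesis unfolding True power_0 by linarith
  next
    case False
    then have "1 \<le> ?k" by simp
    from gen_fools[OF this, of n d] p show ?thesis
      by (simp add: fools_def f)
  qed
  also have "\<dots> \<le> \<epsilon>" using \<epsilon> by (rule precision_bound)
  finally show "\<bar>measure_pmf.expectation (map_pmf (gen n d ?k) (uniform (seed_len n d ?k))) f
      - measure_pmf.expectation (uniform n) f\<bar> \<le> \<epsilon>"
    by (simp only: expectation_uniform U)
qed

lemma lg_ge_1: "1 \<le> lg x"
  by (simp add: lg_def)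

text \<open>Apart from a factor depending on \<open>d\<close>, the seed length is a product of two
  logarithms: the precision is at most \<open>3 * P\<close> and \<open>blen n\<close> at most
  \<open>3 * Q\<close>. Since \<open>lg\<close> is at least one,
  \<open>P \<le> P ^ 3\<close>.\<close>

theorem seed_len_bound:
  assumes n: "n \<ge> 1" and \<epsilon>: "\<epsilon> > 0"
  shows "real (seed_len n d (precision \<epsilon>))
    \<le> 2 powr (12 * real d) * lg (lg (real n) / \<epsilon>) ^ 3 * lg (real n / \<epsilon>)"
proof (cases "d = 0 \<or> precision \<epsilon> = 0")
  case True
  then have "seed_len n d (precision \<epsilon>) = 0" by (auto simp: seed_len_def copies_def)
  then show ?thesis using lg_ge_1 by (simp add: order_trans[OF zero_le_one lg_ge_1])
next
  case False
  let ?k = "precision \<epsilon>"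
  define P where "P = lg (lg (real n) / \<epsilon>)"
  define Q where "Q = lg (real n / \<epsilon>)"
  have PQ: "1 \<le> P" "1 \<le> Q" by (simp_all add: P_def Q_def lg_ge_1)
  have k1: "?k \<ge> 1" using False by simp
  note k = precision_pos_imp[OF \<epsilon> k1]
  have "log 2 (1 / \<epsilon>) \<le> log 2 (lg (real n) / \<epsilon>)"
    using \<epsilon> lg_ge_1[of n] by (subst log_le_cancel_iff) (auto simp: divide_right_mono)
  then have "log 2 (1 / \<epsilon>) \<le> P" by (simp add: P_def lg_def)
  with k PQ have kP: "real ?k \<le> 3 * P" by linarith
  have "real (2 ^ blen n) \<le> real (2 * n)" using blen_le[OF n] by (rule of_nat_mono)
  then have "2 powr real (blen n) \<le> 2 * real n" by (simp add: powr_realpow)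
  then have "real (blen n) \<le> log 2 (2 * real n)" using n by (simp add: le_log_iff)
  also have "\<dots> = 1 + log 2 n" using n by (simp add: log_mult)
  \<comment> \<open>Positive precision means \<open>\<epsilon> < 2\<close>, so passing from
    \<open>n\<close> to \<open>n / \<epsilon>\<close> loses at most one in the logarithm.\<close>
  also have "log 2 n \<le> log 2 (2 * (real n / \<epsilon>))"
    using n \<epsilon> k(2) by (subst log_le_cancel_iff) (auto simp: field_simps)
  also have "\<dots> = 1 + log 2 (real n / \<epsilon>)" using n \<epsilon> by (subst log_mult) auto
  also have "log 2 (real n / \<epsilon>) \<le> Q" by (simp add: Q_def lg_def)
  finally have bQ: "real (blen n) \<le> 3 * Q" using PQ by simp
  \<comment> \<open>864 is 16 * 6 * 3 * 3: blocks per summand, block length, and the bounds by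
    \<open>3 * P\<close> and \<open>3 * Q\<close>. The exponent 12 is 1 + 10 + 1, from
    \<open>d \<le> 2 ^ d\<close>, from 864 being at most 2^10 with \<open>d\<close> positive, and
    from \<open>2 ^ d\<close> itself.\<close>
  have dd: "real d * (864 * 2 ^ d) \<le> 2 powr (12 * real d)"
  proof -
    have "d < 2 ^ d" by (rule less_exp)
    then have "real d \<le> 2 ^ d" by (metis of_nat_less_iff of_nat_numeral of_nat_power less_imp_le)
    moreover have "(864 :: real) \<le> (2 ^ d) ^ 10"
    proof -
      have "(2 :: real) \<le> 2 ^ d" using False power_increasing[of 1 d "2 :: real"] by simp
      then have "(2 :: real) ^ 10 \<le> (2 ^ d) ^ 10" by (intro power_mono) auto
      then show ?thesis by simp
    qed
    ultimately have "real d * (864 * 2 ^ d) \<le> 2 ^ d * ((2 ^ d) ^ 10 * 2 ^ d)"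
      by (intro mult_mono) auto
    also have "\<dots> = 2 ^ (d + (d * 10 + d))"
      by (simp only: power_mult power_add)
    also have "\<dots> = 2 powr real (12 * d)"
      by (subst powr_realpow) (simp_all add: algebra_simps)
    also have "real (12 * d) = 12 * real d" by simp
    finally show ?thesis .
  qed
  have "real (seed_len n d ?k) = real d * (96 * 2 ^ d) * (real ?k * real (blen n))"
    by (simp add: seed_len_def copies_def)
  also have "\<dots> \<le> real d * (96 * 2 ^ d) * ((3 * P) * (3 * Q))"
    using kP bQ PQ by (intro mult_mono) auto
  also have "\<dots> = real d * (864 * 2 ^ d) * (P * Q)" by simp
  also have "\<dots> \<le> 2 powr (12 * real d) * (P ^ 3 * Q)"
    using dd PQ by (intro mult_mono self_le_power) auto
  finally show ?thesis by (simp add: P_def Q_def)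
qed

subsection \<open>Running stack programs\<close>

text \<open>Keeping only an upper bound on the time lets branches of different cost be
  joined.\<close>

definition runs :: "prog \<Rightarrow> store \<Rightarrow> nat \<Rightarrow> store \<Rightarrow> bool" where
  "runs c \<sigma> T \<sigma>' \<longleftrightarrow> (\<exists>t\<le>T. exec c \<sigma> t \<sigma>')"

lemma runs_weaken: "runs c \<sigma> T \<sigma>' \<Longrightarrow> T \<le> T' \<Longrightarrow> \<sigma>' = \<sigma>'' \<Longrightarrow> runs c \<sigma> T' \<sigma>''"
  by (auto simp: runs_def intro: order_trans)

lemma runs_Skip: "runs Skip \<sigma> 1 \<sigma>"
  and runs_Push: "runs (Push r b) \<sigma> 1 (\<sigma>(r := b # \<sigma> r))"
  and runs_Pop: "runs (Pop r) \<sigma> 1 (\<sigma>(r := tl (\<sigma> r)))"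
  unfolding runs_def by (blast intro: exec.intros)+

lemma runs_Seq: "runs c \<sigma> T \<sigma>' \<Longrightarrow> runs c' \<sigma>' T' \<sigma>'' \<Longrightarrow> runs (Seq c c') \<sigma> (T + T') \<sigma>''"
  unfolding runs_def by (meson add_mono exec.Seq)

lemma runs_If: "runs (if \<sigma> r \<noteq> [] \<and> hd (\<sigma> r) = b then c else c') \<sigma> T \<sigma>' \<Longrightarrow> runs (If_Top r b c c') \<sigma> (T + 1) \<sigma>'"
  unfolding runs_def by (smt (verit, best) add_le_mono1 exec.If_False exec.If_True)

lemma runs_If_le:
  assumes "runs (if \<sigma> r \<noteq> [] \<and> hd (\<sigma> r) = b then c else c') \<sigma> T \<sigma>'" "T + 1 \<le> T'"
  shows "runs (If_Top r b c c') \<sigma> T' \<sigma>'"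
  by (rule runs_weaken[OF runs_If]) (use assms in auto)

lemma runs_While_False: "\<sigma> r = [] \<Longrightarrow> runs (While_Nonempty r c) \<sigma> 1 \<sigma>"
  unfolding runs_def by (blast intro: exec.intros)

lemma runs_While_True:
  assumes "\<sigma> r \<noteq> []" "runs c \<sigma> T \<sigma>'" "runs (While_Nonempty r c) \<sigma>' T' \<sigma>''"
  shows "runs (While_Nonempty r c) \<sigma> (T + T' + 1) \<sigma>''"
proof -
  obtain t t' where "t \<le> T" "exec c \<sigma> t \<sigma>'" "t' \<le> T'" "exec (While_Nonempty r c) \<sigma>' t' \<sigma>''"
    using assms by (auto simp: runs_def)
  then show ?thesis
    unfolding runs_def using exec.While_True[of \<sigma> r c t \<sigma>' t' \<sigma>''] assms(1)
    by (intro exI[of _ "t + t' + 1"]) simp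
qed

text \<open>For loops with a known number of rounds, the explicit sequence of stores takes the place
  of an invariant.\<close>

lemma runs_While:
  assumes "\<And>i. i < m \<Longrightarrow> S i r \<noteq> []" "\<And>i. i < m \<Longrightarrow> runs c (S i) T (S (Suc i))" "S m r = []"
  shows "runs (While_Nonempty r c) (S 0) (m * (T + 1) + 1) (S m)"
  using assms
proof (induction m arbitrary: S)
  case 0
  then show ?case using runs_While_False[of "S 0" r c] by simp
next
  case (Suc m)
  have "S 0 r \<noteq> []" "runs c (S 0) T (S (Suc 0))"
    and "runs (While_Nonempty r c) (S (Suc 0)) (m * (T + 1) + 1) (S (Suc m))"
    using Suc.prems Suc.IH[of "\<lambda>i. S (Suc i)"] by auto
  from runs_While_True[OF this] show ?case
    by (rule runs_weaken) auto
qed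

subsection \<open>Stack manipulation\<close>

definition move_top :: "nat \<Rightarrow> nat \<Rightarrow> prog" where
  "move_top r q = If_Top r 1 (Seq (Pop r) (Push q 1)) (Seq (Pop r) (Push q 0))"

lemma runs_move_top:
  assumes "r \<noteq> q" "\<sigma> r = b # l"
  shows "runs (move_top r q) \<sigma> 3 (\<sigma>(r := l, q := b # \<sigma> q))"
  unfolding move_top_def using assms
  by (cases b; intro runs_If_le[where T = 2]; simp;
      intro runs_weaken[OF runs_Seq[OF runs_Pop runs_Push]]; simp)

definition move_count :: "nat \<Rightarrow> nat \<Rightarrow> nat \<Rightarrow> prog" where
  "move_count z r q = While_Nonempty z (Seq (Pop z) (move_top r q))"

lemma runs_move_count:
  assumes "distinct [z, r, q]" "length (\<sigma> z) \<le> length (\<sigma> r)"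
  shows "runs (move_count z r q) \<sigma> (5 * length (\<sigma> z) + 1)
    (\<sigma>(z := [], r := drop (length (\<sigma> z)) (\<sigma> r), q := rev (take (length (\<sigma> z)) (\<sigma> r)) @ \<sigma> q))"
  using assms(2)
proof (induction "\<sigma> z" arbitrary: \<sigma>)
  case Nil
  from Nil.hyps[symmetric] show ?case
    unfolding move_count_def by (intro runs_weaken[OF runs_While_False]) (auto simp: fun_eq_iff)
next
  case (Cons b l)
  note z = Cons.hyps(2)[symmetric]
  obtain a u where r: "\<sigma> r = a # u"
    using Cons.prems z by (cases "\<sigma> r") auto
  define \<sigma>' where "\<sigma>' = \<sigma>(z := l, r := u, q := a # \<sigma> q)"
  have "runs (Seq (Pop z) (move_top r q)) \<sigma> 4 \<sigma>'"
    by (rule runs_weaken[OF runs_Seq[OF runs_Pop runs_move_top]])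
       (use assms(1) r z in \<open>auto simp: \<sigma>'_def fun_eq_iff\<close>)
  moreover have "runs (move_count z r q) \<sigma>' (5 * length (\<sigma>' z) + 1)
      (\<sigma>'(z := [], r := drop (length (\<sigma>' z)) (\<sigma>' r), q := rev (take (length (\<sigma>' z)) (\<sigma>' r)) @ \<sigma>' q))"
    using Cons.prems assms(1) r z by (intro Cons.hyps(1)) (auto simp: \<sigma>'_def)
  ultimately show ?case
    using z unfolding move_count_def
    by (intro runs_weaken[OF runs_While_True[of \<sigma>]])
       (use assms(1) r in \<open>auto simp: \<sigma>'_def fun_eq_iff\<close>)
qed

definition move :: "nat \<Rightarrow> nat \<Rightarrow> prog" where
  "move r q = While_Nonempty r (move_top r q)"

lemma runs_move:
  assumes "r \<noteq> q"
  shows "runs (move r q) \<sigma> (4 * length (\<sigma> r) + 1) (\<sigma>(r := [], q := rev (\<sigma> r) @ \<sigma> q))"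
proof (induction "\<sigma> r" arbitrary: \<sigma>)
  case Nil
  from Nil.hyps[symmetric] show ?case
    unfolding move_def by (intro runs_weaken[OF runs_While_False]) (auto simp: fun_eq_iff)
next
  case (Cons b l)
  note r = Cons.hyps(2)[symmetric]
  define \<sigma>' where "\<sigma>' = \<sigma>(r := l, q := b # \<sigma> q)"
  have "runs (move_top r q) \<sigma> 3 \<sigma>'"
    unfolding \<sigma>'_def by (rule runs_move_top[of _ _ _ b]) (use assms r in auto)
  moreover have "runs (move r q) \<sigma>' (4 * length (\<sigma>' r) + 1) (\<sigma>'(r := [], q := rev (\<sigma>' r) @ \<sigma>' q))"
    using assms by (intro Cons.hyps(1)) (auto simp: \<sigma>'_def)
  ultimately show ?case
    using r unfolding move_def
    by (intro runs_weaken[OF runs_While_True[of \<sigma>]])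
       (use assms in \<open>auto simp: \<sigma>'_def fun_eq_iff\<close>)
qed

definition restore :: "nat \<Rightarrow> nat \<Rightarrow> nat \<Rightarrow> prog" where
  "restore t r q = While_Nonempty t (If_Top t 1
    (Seq (Pop t) (Seq (Push r 1) (Push q 1))) (Seq (Pop t) (Seq (Push r 0) (Push q 0))))"

lemma runs_restore:
  assumes "distinct [t, r, q]"
  shows "runs (restore t r q) \<sigma> (5 * length (\<sigma> t) + 1)
    (\<sigma>(t := [], r := rev (\<sigma> t) @ \<sigma> r, q := rev (\<sigma> t) @ \<sigma> q))"
proof (induction "\<sigma> t" arbitrary: \<sigma>)
  case Nil
  from Nil.hyps[symmetric] show ?case
    unfolding restore_def by (intro runs_weaken[OF runs_While_False]) (auto simp: fun_eq_iff)
next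
  case (Cons b l)
  note t = Cons.hyps(2)[symmetric]
  define \<sigma>' where "\<sigma>' = \<sigma>(t := l, r := b # \<sigma> r, q := b # \<sigma> q)"
  have "runs (If_Top t 1 (Seq (Pop t) (Seq (Push r 1) (Push q 1)))
      (Seq (Pop t) (Seq (Push r 0) (Push q 0)))) \<sigma> 4 \<sigma>'"
    using t assms
    by (cases b; intro runs_If_le[where T = 3]; simp;
        intro runs_weaken[OF runs_Seq[OF runs_Pop runs_Seq[OF runs_Push runs_Push]]];
        auto simp: \<sigma>'_def fun_eq_iff)
  moreover have "runs (restore t r q) \<sigma>' (5 * length (\<sigma>' t) + 1)
      (\<sigma>'(t := [], r := rev (\<sigma>' t) @ \<sigma>' r, q := rev (\<sigma>' t) @ \<sigma>' q))"
    using assms by (intro Cons.hyps(1)) (auto simp: \<sigma>'_def)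
  ultimately show ?case
    using t unfolding restore_def
    by (intro runs_weaken[OF runs_While_True[of \<sigma>]])
       (use assms in \<open>auto simp: \<sigma>'_def fun_eq_iff\<close>)
qed

text \<open>Reading a stack destroys it, so a copy passes through the scratch stack
  \<open>t\<close>; the two reversals cancel.\<close>

definition copy :: "nat \<Rightarrow> nat \<Rightarrow> nat \<Rightarrow> prog" where
  "copy t r q = Seq (move r t) (restore t r q)"

lemma runs_copy:
  assumes "distinct [t, r, q]" "\<sigma> t = []"
  shows "runs (copy t r q) \<sigma> (9 * length (\<sigma> r) + 2) (\<sigma>(q := \<sigma> r @ \<sigma> q))"
  unfolding copy_def
  by (rule runs_weaken[OF runs_Seq[OF runs_move runs_restore]])
     (use assms in \<open>auto simp: fun_eq_iff\<close>)

definition clear :: "nat \<Rightarrow> prog" where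
  "clear r = While_Nonempty r (Pop r)"

lemma runs_clear: "runs (clear r) \<sigma> (2 * length (\<sigma> r) + 1) (\<sigma>(r := []))"
proof (induction "\<sigma> r" arbitrary: \<sigma>)
  case Nil
  from Nil.hyps[symmetric] show ?case
    unfolding clear_def by (intro runs_weaken[OF runs_While_False]) (auto simp: fun_eq_iff)
next
  case (Cons b l)
  note r = Cons.hyps(2)[symmetric]
  have "runs (clear r) (\<sigma>(r := l)) (2 * length l + 1) (\<sigma>(r := []))"
    using Cons.hyps(1)[of "\<sigma>(r := l)"] by simp
  with runs_Pop[of r \<sigma>] r show ?case
    unfolding clear_def by (intro runs_weaken[OF runs_While_True[of \<sigma>]]) auto
qed

text \<open>The factor \<open>c\<close> is unrolled into the program text, which multiplies a length
  by a constant.\<close>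

definition emit :: "nat \<Rightarrow> nat \<Rightarrow> nat \<Rightarrow> prog" where
  "emit c r q = While_Nonempty r (Seq (Pop r) ((Seq (Push q 1) ^^ c) Skip))"

lemma runs_pushes: "runs ((Seq (Push q 1) ^^ c) Skip) \<sigma> (c + 1) (\<sigma>(q := unary c @ \<sigma> q))"
proof (induction c arbitrary: \<sigma>)
  case 0
  show ?case using runs_Skip[of \<sigma>] by (simp add: unary_def)
next
  case (Suc c)
  have "unary c @ 1 # l = 1 # unary c @ l" for l
    by (simp add: unary_def replicate_app_Cons_same)
  then show ?case
    using runs_Seq[OF runs_Push Suc, of q 1 \<sigma>] by (auto elim!: runs_weaken simp: unary_def)
qed

lemma unary_append: "unary a @ unary b = unary (a + b)" "unary a @ unary b @ l = unary (a + b) @ l"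
  by (simp_all add: unary_def replicate_add)

lemma length_unary [simp]: "length (unary a) = a"
  by (simp add: unary_def)

lemma unary_0 [simp]: "unary 0 = []"
  by (simp add: unary_def)

lemma runs_emit:
  assumes "r \<noteq> q"
  shows "runs (emit c r q) \<sigma> ((c + 3) * length (\<sigma> r) + 1)
    (\<sigma>(r := [], q := unary (c * length (\<sigma> r)) @ \<sigma> q))"
proof (induction "\<sigma> r" arbitrary: \<sigma>)
  case Nil
  from Nil.hyps[symmetric] show ?case
    unfolding emit_def by (intro runs_weaken[OF runs_While_False]) (auto simp: fun_eq_iff)
next
  case (Cons b l)
  note r = Cons.hyps(2)[symmetric]
  define \<sigma>' where "\<sigma>' = \<sigma>(r := l, q := unary c @ \<sigma> q)"
  have "runs (Seq (Pop r) ((Seq (Push q 1) ^^ c) Skip)) \<sigma> (c + 2) \<sigma>'"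
    by (rule runs_weaken[OF runs_Seq[OF runs_Pop runs_pushes]])
       (use assms r in \<open>auto simp: \<sigma>'_def fun_eq_iff\<close>)
  moreover have "runs (emit c r q) \<sigma>' ((c + 3) * length (\<sigma>' r) + 1)
      (\<sigma>'(r := [], q := unary (c * length (\<sigma>' r)) @ \<sigma>' q))"
    using assms by (intro Cons.hyps(1)) (auto simp: \<sigma>'_def)
  ultimately show ?case
    using r unfolding emit_def
    by (intro runs_weaken[OF runs_While_True[of \<sigma>]])
       (use assms in \<open>auto simp: \<sigma>'_def fun_eq_iff unary_append add.commute\<close>)
qed

definition toggle :: "nat \<Rightarrow> prog" where
  "toggle h = If_Top h 1 (Seq (Pop h) (Push h 0)) (Seq (Pop h) (Push h 1))"

lemma runs_toggle:
  assumes "\<sigma> h = b # l"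
  shows "runs (toggle h) \<sigma> 3 (\<sigma>(h := (b + 1) # l))"
  unfolding toggle_def using assms
  by (cases b; intro runs_If_le[where T = 2]; simp;
      intro runs_weaken[OF runs_Seq[OF runs_Pop runs_Push]]; simp)

subsection \<open>Incrementing a binary counter\<close>

text \<open>Loops test only for emptiness, so the stack \<open>f\<close> is nonempty while a carry
  is pending. Zeros left by the carry are parked on \<open>t\<close>. Popping an empty
  \<open>x\<close> has no effect, which yields \<open>inc [] = [1]\<close>.\<close>

definition incr_loop :: "nat \<Rightarrow> nat \<Rightarrow> nat \<Rightarrow> prog" where
  "incr_loop f t x = While_Nonempty f (If_Top x 1 (Seq (Pop x) (Push t 0))
    (Seq (Pop x) (Seq (Push x 1) (Pop f))))"

definition incr :: "nat \<Rightarrow> nat \<Rightarrow> nat \<Rightarrow> prog" where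
  "incr f t x = Seq (Push f 1) (Seq (incr_loop f t x) (move t x))"

lemma runs_incr_loop:
  assumes "distinct [f, t, x]" "\<sigma> f = [1]"
  shows "\<exists>y z. runs (incr_loop f t x) \<sigma> (4 * length (\<sigma> x) + 6) (\<sigma>(f := [], x := y, t := rev z @ \<sigma> t)) \<and>
    z @ y = inc (\<sigma> x) \<and> length z \<le> length (\<sigma> x)"
  using assms(2)
proof (induction "\<sigma> x" arbitrary: \<sigma> rule: inc.induct)
  case 1
  note x = 1(1)[symmetric]
  have "runs (If_Top x 1 (Seq (Pop x) (Push t 0)) (Seq (Pop x) (Seq (Push x 1) (Pop f)))) \<sigma> 4
      (\<sigma>(f := [], x := [1]))"
    by (rule runs_If_le[where T = 3], simp add: x,
        rule runs_weaken[OF runs_Seq[OF runs_Pop runs_Seq[OF runs_Push runs_Pop]]])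
       (use assms(1) x 1(2) in \<open>auto simp: fun_eq_iff\<close>)
  from runs_While_True[OF _ this runs_While_False] 1(2) assms(1)
  have "runs (incr_loop f t x) \<sigma> 6 (\<sigma>(f := [], x := [1]))"
    by (auto simp: incr_loop_def)
  then have "runs (incr_loop f t x) \<sigma> (4 * length (\<sigma> x) + 6) (\<sigma>(f := [], x := [1], t := rev [] @ \<sigma> t))"
    by (rule runs_weaken) (use assms(1) in \<open>auto simp: fun_eq_iff\<close>)
  moreover have "[] @ [1] = inc (\<sigma> x)" "length [] \<le> length (\<sigma> x)" by (simp_all add: x)
  ultimately show ?case by blast
next
  case (2 b l)
  note x = 2(2)[symmetric]
  show ?case
  proof (cases "b = 1")
    case True
    define \<sigma>' where "\<sigma>' = \<sigma>(x := l, t := 0 # \<sigma> t)"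
    have *: "runs (If_Top x 1 (Seq (Pop x) (Push t 0)) (Seq (Pop x) (Seq (Push x 1) (Pop f)))) \<sigma> 3 \<sigma>'"
    proof (rule runs_If_le)
      have "runs (Seq (Pop x) (Push t 0)) \<sigma> 2 \<sigma>'"
        by (rule runs_weaken[OF runs_Seq[OF runs_Pop runs_Push]])
           (use assms(1) x in \<open>auto simp: fun_eq_iff \<sigma>'_def\<close>)
      then show "runs (if \<sigma> x \<noteq> [] \<and> hd (\<sigma> x) = 1 then Seq (Pop x) (Push t 0)
          else Seq (Pop x) (Seq (Push x 1) (Pop f))) \<sigma> 2 \<sigma>'"
        by (simp add: x True)
    qed simp
    have "l = \<sigma>' x" "\<sigma>' f = [1]" using assms(1) 2(3) by (auto simp: \<sigma>'_def)
    from 2(1)[OF True this] this(1)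
    obtain y z where yz: "runs (incr_loop f t x) \<sigma>' (4 * length l + 6) (\<sigma>'(f := [], x := y, t := rev z @ \<sigma>' t))"
      "z @ y = inc l" "length z \<le> length l" by auto
    have "runs (incr_loop f t x) \<sigma> (3 + (4 * length l + 6) + 1) (\<sigma>'(f := [], x := y, t := rev z @ \<sigma>' t))"
      using runs_While_True[OF _ * yz(1)[unfolded incr_loop_def]] 2(3) by (simp add: incr_loop_def)
    then have "runs (incr_loop f t x) \<sigma> (4 * length (\<sigma> x) + 6) (\<sigma>(f := [], x := y, t := rev (0 # z) @ \<sigma> t))"
      by (rule runs_weaken) (use assms(1) x in \<open>auto simp: \<sigma>'_def fun_eq_iff\<close>)
    moreover have "(0 # z) @ y = inc (\<sigma> x)" "length (0 # z) \<le> length (\<sigma> x)"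
      using yz True by (simp_all add: x)
    ultimately show ?thesis by blast
  next
    case False
    have "runs (If_Top x 1 (Seq (Pop x) (Push t 0)) (Seq (Pop x) (Seq (Push x 1) (Pop f)))) \<sigma> 4
        (\<sigma>(f := [], x := 1 # l))"
      by (rule runs_If_le[where T = 3], use x False in simp,
          rule runs_weaken[OF runs_Seq[OF runs_Pop runs_Seq[OF runs_Push runs_Pop]]])
         (use assms(1) 2(3) x in \<open>auto simp: fun_eq_iff\<close>)
    from runs_While_True[OF _ this runs_While_False] 2(3) assms(1)
    have "runs (incr_loop f t x) \<sigma> 6 (\<sigma>(f := [], x := 1 # l))"
      by (auto simp: incr_loop_def)
    then have "runs (incr_loop f t x) \<sigma> (4 * length (\<sigma> x) + 6) (\<sigma>(f := [], x := 1 # l, t := rev [] @ \<sigma> t))"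
      by (rule runs_weaken) (use assms(1) in \<open>auto simp: fun_eq_iff\<close>)
    moreover have "[] @ (1 # l) = inc (\<sigma> x)" "length [] \<le> length (\<sigma> x)"
      using False by (simp_all add: x)
    ultimately show ?thesis by blast
  qed
qed

lemma runs_incr:
  assumes "distinct [f, t, x]" "\<sigma> f = []" "\<sigma> t = []"
  shows "runs (incr f t x) \<sigma> (8 * length (\<sigma> x) + 8) (\<sigma>(x := inc (\<sigma> x)))"
proof -
  define \<sigma>' where "\<sigma>' = \<sigma>(f := [1])"
  have "\<sigma>' f = [1]" by (simp add: \<sigma>'_def)
  from runs_incr_loop[of f t x \<sigma>', OF assms(1) this] obtain y z where yz:
    "runs (incr_loop f t x) \<sigma>' (4 * length (\<sigma> x) + 6) (\<sigma>(f := [], x := y, t := rev z))"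
    "z @ y = inc (\<sigma> x)" "length z \<le> length (\<sigma> x)"
    using assms by (auto simp: \<sigma>'_def)
  have "runs (incr f t x) \<sigma> (1 + ((4 * length (\<sigma> x) + 6) + (4 * length (rev z) + 1))) (\<sigma>(x := inc (\<sigma> x)))"
    unfolding incr_def
  proof (rule runs_Seq, rule runs_weaken[OF runs_Push])
    show "runs (Seq (incr_loop f t x) (move t x)) \<sigma>' ((4 * length (\<sigma> x) + 6) + (4 * length (rev z) + 1)) (\<sigma>(x := inc (\<sigma> x)))"
      by (rule runs_Seq[OF yz(1)], rule runs_weaken[OF runs_move])
         (use assms yz(2) in \<open>auto simp: fun_eq_iff\<close>)
  qed (use assms in \<open>auto simp: \<sigma>'_def\<close>)
  then show ?thesis
    by (rule runs_weaken) (use yz(3) in auto)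
qed

subsection \<open>The generator as a program\<close>

text \<open>
  Stack 0 holds the remaining number of output bits, 3 the seed, 4 the binary counter, 5 the
  number of triples of a block in unary, 7 the unread part of the seed, 9, 10 and 11 the current
  block, 8 the current output bit, 12 the current hash bit, and 16 the output in reverse.
\<close>

definition dot_prog :: "nat \<Rightarrow> nat \<Rightarrow> nat \<Rightarrow> prog" where
  "dot_prog y a h = While_Nonempty y
    (Seq (If_Top y 1 (If_Top a 1 (toggle h) Skip) Skip) (Seq (Pop y) (Pop a)))"

lemma runs_dot_prog:
  assumes "distinct [y, a, h]" "\<sigma> h = b # hs"
  shows "runs (dot_prog y a h) \<sigma> (8 * length (\<sigma> y) + 1)
    (\<sigma>(y := [], a := drop (length (\<sigma> y)) (\<sigma> a), h := dot_acc (\<sigma> y) (\<sigma> a) b # hs))"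
  using assms(2)
proof (induction "\<sigma> y" arbitrary: \<sigma> b)
  case Nil
  from Nil.hyps[symmetric] Nil.prems show ?case
    unfolding dot_prog_def by (intro runs_weaken[OF runs_While_False]) (auto simp: fun_eq_iff)
next
  case (Cons x l)
  note y = Cons.hyps(2)[symmetric]
  define b' where "b' = (if x = 1 \<and> \<sigma> a \<noteq> [] \<and> hd (\<sigma> a) = 1 then b + 1 else b)"
  define \<sigma>' where "\<sigma>' = \<sigma>(y := l, a := tl (\<sigma> a), h := b' # hs)"
  have "runs (If_Top y 1 (If_Top a 1 (toggle h) Skip) Skip) \<sigma> 5 (\<sigma>(h := b' # hs))"
  proof (rule runs_If_le)
    have "runs Skip \<sigma> 4 \<sigma>" by (rule runs_weaken[OF runs_Skip]) auto
    moreover have "runs (If_Top a 1 (toggle h) Skip) \<sigma> 4 (\<sigma>(h := (if \<sigma> a \<noteq> [] \<and> hd (\<sigma> a) = 1 then b + 1 else b) # hs))"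
      by (rule runs_If_le[where T = 3])
         (use runs_toggle[of \<sigma> h, OF Cons.prems] runs_weaken[OF runs_Skip, of 3 \<sigma> \<sigma>] Cons.prems in \<open>auto simp: fun_upd_idem\<close>)
    ultimately show "runs (if \<sigma> y \<noteq> [] \<and> hd (\<sigma> y) = 1 then If_Top a 1 (toggle h) Skip else Skip) \<sigma> 4 (\<sigma>(h := b' # hs))"
      using y Cons.prems by (cases x) (simp_all add: b'_def fun_upd_idem)
  qed simp
  from runs_Seq[OF this runs_Seq[OF runs_Pop runs_Pop]]
  have "runs (Seq (If_Top y 1 (If_Top a 1 (toggle h) Skip) Skip) (Seq (Pop y) (Pop a))) \<sigma> 7 \<sigma>'"
    by (rule runs_weaken) (use assms(1) y in \<open>auto simp: \<sigma>'_def fun_eq_iff\<close>)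
  moreover have "runs (dot_prog y a h) \<sigma>' (8 * length (\<sigma>' y) + 1)
      (\<sigma>'(y := [], a := drop (length (\<sigma>' y)) (\<sigma>' a), h := dot_acc (\<sigma>' y) (\<sigma>' a) b' # hs))"
    using assms(1) by (intro Cons.hyps(1)) (auto simp: \<sigma>'_def)
  ultimately show ?case
    using y unfolding dot_prog_def
    by (intro runs_weaken[OF runs_While_True[of \<sigma>]])
       (use assms(1) in \<open>auto simp: \<sigma>'_def b'_def fun_eq_iff drop_Suc tl_drop\<close>)
qed

text \<open>One hash bit is computed on copies of the index and of \<open>A\<close>. A hit ends the
  enclosing loop by clearing stack 10, which controls it.\<close>

definition scan_body :: prog where
  "scan_body = Seq (move_top 10 12) (Seq (copy 15 4 13) (Seq (copy 15 9 14)
    (Seq (dot_prog 13 14 12) (Seq (clear 14)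
    (Seq (If_Top 12 1 (Seq (If_Top 11 1 (toggle 8) Skip) (clear 10)) (Seq (Pop 9) (Pop 11))) (Pop 12))))))"

lemma runs_scan_body:
  assumes B: "\<sigma> 10 = b # B" and F: "\<sigma> 8 = [f]"
    and e: "\<sigma> 12 = []" "\<sigma> 13 = []" "\<sigma> 14 = []" "\<sigma> 15 = []"
  defines "h \<equiv> dot_acc (\<sigma> 4) (\<sigma> 9) b"
  shows "runs scan_body \<sigma> (17 * length (\<sigma> 4) + 11 * length (\<sigma> 9) + 2 * length B + 17)
    (if h = 1 then \<sigma>(10 := [], 8 := [f + (if \<sigma> 11 \<noteq> [] \<and> hd (\<sigma> 11) = 1 then 1 else 0)])
     else \<sigma>(10 := B, 9 := tl (\<sigma> 9), 11 := tl (\<sigma> 11)))"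
proof -
  let ?X = "length (\<sigma> 4)" and ?A = "length (\<sigma> 9)"
  let ?f = "f + (if \<sigma> 11 \<noteq> [] \<and> hd (\<sigma> 11) = 1 then 1 else 0)"
  define \<sigma>0 where "\<sigma>0 = \<sigma>(10 := B, 12 := [b])"
  define \<sigma>1 where "\<sigma>1 = \<sigma>0(13 := \<sigma> 4)"
  define \<sigma>2 where "\<sigma>2 = \<sigma>1(14 := \<sigma> 9)"
  define \<sigma>3 where "\<sigma>3 = \<sigma>2(13 := [], 14 := drop ?X (\<sigma> 9), 12 := [h])"
  define \<sigma>4 where "\<sigma>4 = \<sigma>(10 := B, 12 := [h])"
  note defs = \<sigma>0_def \<sigma>1_def \<sigma>2_def \<sigma>3_def \<sigma>4_def
  have 0: "runs (move_top 10 12) \<sigma> 3 \<sigma>0"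
    by (rule runs_weaken[OF runs_move_top]) (use B e in \<open>auto simp: defs\<close>)
  have 1: "runs (copy 15 4 13) \<sigma>0 (9 * ?X + 2) \<sigma>1"
    by (rule runs_weaken[OF runs_copy]) (use e in \<open>auto simp: defs fun_eq_iff\<close>)
  have 2: "runs (copy 15 9 14) \<sigma>1 (9 * ?A + 2) \<sigma>2"
    by (rule runs_weaken[OF runs_copy]) (use e in \<open>auto simp: defs fun_eq_iff\<close>)
  have 3: "runs (dot_prog 13 14 12) \<sigma>2 (8 * ?X + 1) \<sigma>3"
    by (rule runs_weaken[OF runs_dot_prog[of _ _ _ _ b "[]"]]) (use e in \<open>auto simp: defs fun_eq_iff h_def\<close>)
  have 4: "runs (clear 14) \<sigma>3 (2 * ?A + 1) \<sigma>4"
    by (rule runs_weaken[OF runs_clear]) (use e in \<open>auto simp: defs fun_eq_iff\<close>)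
  show ?thesis
  proof (cases "h = 1")
    case True
    have s8: "\<sigma>4 8 = f # []" using F by (simp add: defs)
    have "runs (If_Top 11 1 (toggle 8) Skip) \<sigma>4 4 (\<sigma>4(8 := [?f]))"
      by (rule runs_If_le[where T = 3])
         (use runs_toggle[of \<sigma>4 8, OF s8] runs_weaken[OF runs_Skip, of 3 \<sigma>4 \<sigma>4] s8 in
           \<open>auto simp: fun_upd_idem defs\<close>)
    from runs_Seq[OF this runs_clear]
    have "runs (Seq (If_Top 11 1 (toggle 8) Skip) (clear 10)) \<sigma>4 (2 * length B + 5) (\<sigma>4(8 := [?f], 10 := []))"
      by (rule runs_weaken) (auto simp: defs)
    then have "runs (If_Top 12 1 (Seq (If_Top 11 1 (toggle 8) Skip) (clear 10)) (Seq (Pop 9) (Pop 11))) \<sigma>4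
        (2 * length B + 6) (\<sigma>4(8 := [?f], 10 := []))"
      by (intro runs_If_le[where T = "2 * length B + 5"]) (simp_all add: defs True)
    from runs_Seq[OF 0 runs_Seq[OF 1 runs_Seq[OF 2 runs_Seq[OF 3 runs_Seq[OF 4 runs_Seq[OF this runs_Pop]]]]]]
    show ?thesis
      unfolding scan_body_def
      by (rule runs_weaken) (use e True in \<open>auto simp: defs fun_eq_iff\<close>)
  next
    case False
    have "runs (Seq (Pop 9) (Pop 11)) \<sigma>4 2 (\<sigma>4(9 := tl (\<sigma> 9), 11 := tl (\<sigma> 11)))"
      by (rule runs_weaken[OF runs_Seq[OF runs_Pop runs_Pop]]) (auto simp: defs)
    then have "runs (If_Top 12 1 (Seq (If_Top 11 1 (toggle 8) Skip) (clear 10)) (Seq (Pop 9) (Pop 11))) \<sigma>4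
        3 (\<sigma>4(9 := tl (\<sigma> 9), 11 := tl (\<sigma> 11)))"
      using False by (intro runs_If_le[where T = 2]) (simp_all add: defs)
    from runs_Seq[OF 0 runs_Seq[OF 1 runs_Seq[OF 2 runs_Seq[OF 3 runs_Seq[OF 4 runs_Seq[OF this runs_Pop]]]]]]
    show ?thesis
      unfolding scan_body_def
      by (rule runs_weaken) (use e False in \<open>auto simp: defs fun_eq_iff\<close>)
  qed
qed

definition scan_prog :: prog where
  "scan_prog = Seq (While_Nonempty 10 scan_body) (Seq (clear 9) (clear 11))"

text \<open>What remains on stacks 9 and 11 depends on where the scan stopped; only its length
  matters, for the cost of clearing.\<close>

lemma runs_scan_loop:
  assumes "\<sigma> 8 = [f]" "\<sigma> 12 = []" "\<sigma> 13 = []" "\<sigma> 14 = []" "\<sigma> 15 = []"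
    and "length (\<sigma> 4) \<le> m" "length (\<sigma> 9) \<le> m" "length (\<sigma> 10) \<le> m" "length (\<sigma> 11) \<le> m"
  shows "\<exists>A W. runs (While_Nonempty 10 scan_body) \<sigma> (length (\<sigma> 10) * (30 * m + 18) + 1)
    (\<sigma>(8 := [f + scan (\<sigma> 4) (\<sigma> 9) (\<sigma> 10) (\<sigma> 11)], 9 := A, 10 := [], 11 := W)) \<and> length A \<le> m \<and> length W \<le> m"
  using assms
proof (induction "\<sigma> 10" arbitrary: \<sigma>)
  case Nil
  have "runs (While_Nonempty 10 scan_body) \<sigma> (length (\<sigma> 10) * (30 * m + 18) + 1)
      (\<sigma>(8 := [f + scan (\<sigma> 4) (\<sigma> 9) (\<sigma> 10) (\<sigma> 11)], 9 := \<sigma> 9, 10 := [], 11 := \<sigma> 11))"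
    by (rule runs_weaken[OF runs_While_False]) (use Nil.hyps[symmetric] Nil.prems in \<open>auto simp: fun_eq_iff\<close>)
  then show ?case using Nil.prems(7,9) by blast
next
  case (Cons b B)
  note B = Cons.hyps(2)[symmetric]
  let ?h = "dot_acc (\<sigma> 4) (\<sigma> 9) b"
  define T where "T = 30 * m + 17"
  define \<sigma>' where "\<sigma>' = (if ?h = 1 then \<sigma>(10 := [], 8 := [f + (if \<sigma> 11 \<noteq> [] \<and> hd (\<sigma> 11) = 1 then 1 else 0)])
     else \<sigma>(10 := B, 9 := tl (\<sigma> 9), 11 := tl (\<sigma> 11)))"
  have body: "runs scan_body \<sigma> T \<sigma>'"
    by (rule runs_weaken[OF runs_scan_body[OF B Cons.prems(1-5)]])
       (use Cons.prems B in \<open>auto simp: \<sigma>'_def T_def\<close>)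
  show ?case
  proof (cases "?h = 1")
    case True
    have "runs (While_Nonempty 10 scan_body) \<sigma>' 1 \<sigma>'"
      by (rule runs_While_False) (simp add: \<sigma>'_def True)
    from runs_While_True[OF _ body this]
    have "runs (While_Nonempty 10 scan_body) \<sigma> (length (\<sigma> 10) * (30 * m + 18) + 1)
      (\<sigma>(8 := [f + scan (\<sigma> 4) (\<sigma> 9) (\<sigma> 10) (\<sigma> 11)], 9 := \<sigma> 9, 10 := [], 11 := \<sigma> 11))"
      by (rule runs_weaken) (use B True in \<open>auto simp: \<sigma>'_def T_def fun_eq_iff\<close>)
    then show ?thesis using Cons.prems(7,9) by blast
  next
    case False
    have "B = \<sigma>' 10" "\<sigma>' 8 = [f]" "\<sigma>' 12 = []" "\<sigma>' 13 = []" "\<sigma>' 14 = []" "\<sigma>' 15 = []"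
      "length (\<sigma>' 4) \<le> m" "length (\<sigma>' 9) \<le> m" "length (\<sigma>' 10) \<le> m" "length (\<sigma>' 11) \<le> m"
      using Cons.prems B False by (auto simp: \<sigma>'_def)
    from Cons.hyps(1)[OF this] obtain A W where
      "runs (While_Nonempty 10 scan_body) \<sigma>' (length (\<sigma>' 10) * (30 * m + 18) + 1)
        (\<sigma>'(8 := [f + scan (\<sigma>' 4) (\<sigma>' 9) (\<sigma>' 10) (\<sigma>' 11)], 9 := A, 10 := [], 11 := W))"
      and AW: "length A \<le> m" "length W \<le> m" by auto
    from runs_While_True[OF _ body this(1)]
    have "runs (While_Nonempty 10 scan_body) \<sigma> (length (\<sigma> 10) * (30 * m + 18) + 1)
      (\<sigma>(8 := [f + scan (\<sigma> 4) (\<sigma> 9) (\<sigma> 10) (\<sigma> 11)], 9 := A, 10 := [], 11 := W))"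
      by (rule runs_weaken) (use B False in \<open>auto simp: \<sigma>'_def T_def fun_eq_iff\<close>)
    with AW show ?thesis by blast
  qed
qed

lemma runs_scan_prog:
  assumes "\<sigma> 8 = [f]" "\<sigma> 12 = []" "\<sigma> 13 = []" "\<sigma> 14 = []" "\<sigma> 15 = []"
    and "length (\<sigma> 4) \<le> m" "length (\<sigma> 9) \<le> m" "length (\<sigma> 10) \<le> m" "length (\<sigma> 11) \<le> m"
  shows "runs scan_prog \<sigma> (30 * m * m + 22 * m + 3)
    (\<sigma>(8 := [f + scan (\<sigma> 4) (\<sigma> 9) (\<sigma> 10) (\<sigma> 11)], 9 := [], 10 := [], 11 := []))"
proof -
  from runs_scan_loop[OF assms] obtain A W where
    *: "runs (While_Nonempty 10 scan_body) \<sigma> (length (\<sigma> 10) * (30 * m + 18) + 1)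
      (\<sigma>(8 := [f + scan (\<sigma> 4) (\<sigma> 9) (\<sigma> 10) (\<sigma> 11)], 9 := A, 10 := [], 11 := W))"
    "length A \<le> m" "length W \<le> m" by blast
  have "length (\<sigma> 10) * (30 * m + 18) \<le> m * (30 * m + 18)"
    using assms(8) by (rule mult_le_mono1)
  then have T: "length (\<sigma> 10) * (30 * m + 18) \<le> 30 * m * m + 18 * m"
    by (simp add: algebra_simps)
  show ?thesis
    unfolding scan_prog_def
    by (rule runs_weaken[OF runs_Seq[OF *(1) runs_Seq[OF runs_clear runs_clear]]])
       (use T *(2,3) in \<open>auto simp: fun_eq_iff\<close>)
qed

definition take_prog :: "nat \<Rightarrow> prog" where
  "take_prog q = Seq (copy 15 5 6) (move_count 6 7 q)"

lemma runs_take_prog: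
  assumes "distinct [5, 6, 7, 15, q]" "\<sigma> 15 = []" "\<sigma> 6 = []" "\<sigma> q = []" "length (\<sigma> 5) = L" "L \<le> length (\<sigma> 7)"
  shows "runs (take_prog q) \<sigma> (14 * L + 3) (\<sigma>(7 := drop L (\<sigma> 7), q := rev (take L (\<sigma> 7))))"
  unfolding take_prog_def
  by (rule runs_weaken[OF runs_Seq[OF runs_copy runs_move_count]])
     (use assms in \<open>auto simp: fun_eq_iff\<close>)

definition chunk_prog :: prog where
  "chunk_prog = Seq (take_prog 9) (Seq (take_prog 10) (Seq (take_prog 11) scan_prog))"

definition scratch_empty :: "store \<Rightarrow> bool" where
  "scratch_empty \<sigma> \<longleftrightarrow> (\<forall>r\<in>{6, 9, 10, 11, 12, 13, 14, 15}. \<sigma> r = [])"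

lemma runs_chunk_prog:
  assumes \<sigma>: "scratch_empty \<sigma>" "\<sigma> 8 = [f]" "length (\<sigma> 5) = L" "3 * L \<le> length (\<sigma> 7)" "length (\<sigma> 4) \<le> L"
  shows "runs chunk_prog \<sigma> (30 * L * L + 64 * L + 12)
    (\<sigma>(8 := [f + chunk_bit L (\<sigma> 4) (\<sigma> 7)], 7 := drop (3 * L) (\<sigma> 7)))"
proof -
  define \<sigma>1 where "\<sigma>1 = \<sigma>(7 := drop L (\<sigma> 7), 9 := rev (take L (\<sigma> 7)))"
  define \<sigma>2 where "\<sigma>2 = \<sigma>1(7 := drop L (\<sigma>1 7), 10 := rev (take L (\<sigma>1 7)))"
  define \<sigma>3 where "\<sigma>3 = \<sigma>2(7 := drop L (\<sigma>2 7), 11 := rev (take L (\<sigma>2 7)))"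
  note defs = \<sigma>1_def \<sigma>2_def \<sigma>3_def
  have 1: "runs (take_prog 9) \<sigma> (14 * L + 3) \<sigma>1"
    unfolding \<sigma>1_def by (rule runs_take_prog) (use \<sigma> in \<open>auto simp: scratch_empty_def\<close>)
  have 2: "runs (take_prog 10) \<sigma>1 (14 * L + 3) \<sigma>2"
    unfolding \<sigma>2_def by (rule runs_take_prog) (use \<sigma> in \<open>auto simp: scratch_empty_def defs\<close>)
  have 3: "runs (take_prog 11) \<sigma>2 (14 * L + 3) \<sigma>3"
    unfolding \<sigma>3_def by (rule runs_take_prog) (use \<sigma> in \<open>auto simp: scratch_empty_def defs\<close>)
  have 4: "runs scan_prog \<sigma>3 (30 * L * L + 22 * L + 3)
      (\<sigma>3(8 := [f + scan (\<sigma>3 4) (\<sigma>3 9) (\<sigma>3 10) (\<sigma>3 11)], 9 := [], 10 := [], 11 := []))"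
    by (rule runs_scan_prog) (use \<sigma> in \<open>auto simp: scratch_empty_def defs\<close>)
  have "scan (\<sigma>3 4) (\<sigma>3 9) (\<sigma>3 10) (\<sigma>3 11) = chunk_bit L (\<sigma> 4) (\<sigma> 7)"
    by (simp add: chunk_bit_def defs)
  moreover have "\<sigma>3(8 := [g], 9 := [], 10 := [], 11 := []) = \<sigma>(8 := [g], 7 := drop (3 * L) (\<sigma> 7))" for g
    using \<sigma>(1) by (auto simp: fun_eq_iff defs scratch_empty_def numeral_3_eq_3 add.assoc)
  ultimately show ?thesis
    unfolding chunk_prog_def
    by (intro runs_weaken[OF runs_Seq[OF 1 runs_Seq[OF 2 runs_Seq[OF 3 4]]]]) auto
qed

text \<open>The unread seed drives the loop, so \<open>D\<close> enters only through the length of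
  the seed and is stored on no stack. The bound \<open>1 \<le> L\<close> ensures that remaining
  blocks are visible as a nonempty stack.\<close>

lemma runs_chunks:
  assumes "scratch_empty \<sigma>" "\<sigma> 8 = [f]" "length (\<sigma> 5) = L" "length (\<sigma> 7) = D * (3 * L)" "length (\<sigma> 4) \<le> L" "1 \<le> L"
  shows "runs (While_Nonempty 7 chunk_prog) \<sigma> (D * (30 * L * L + 64 * L + 13) + 1)
    (\<sigma>(8 := [f + chunks L (\<sigma> 4) D (\<sigma> 7)], 7 := []))"
  using assms
proof (induction D arbitrary: \<sigma> f)
  case 0
  then show ?case by (intro runs_weaken[OF runs_While_False]) (auto simp: fun_eq_iff)
next
  case (Suc D)
  define \<sigma>' where "\<sigma>' = \<sigma>(8 := [f + chunk_bit L (\<sigma> 4) (\<sigma> 7)], 7 := drop (3 * L) (\<sigma> 7))"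
  have 1: "runs chunk_prog \<sigma> (30 * L * L + 64 * L + 12) \<sigma>'"
    unfolding \<sigma>'_def using Suc.prems by (intro runs_chunk_prog) auto
  have 2: "runs (While_Nonempty 7 chunk_prog) \<sigma>' (D * (30 * L * L + 64 * L + 13) + 1)
      (\<sigma>'(8 := [(f + chunk_bit L (\<sigma> 4) (\<sigma> 7)) + chunks L (\<sigma>' 4) D (\<sigma>' 7)], 7 := []))"
    using Suc.prems by (intro Suc.IH) (auto simp: \<sigma>'_def scratch_empty_def)
  have "\<sigma> 7 \<noteq> []" using Suc.prems(4,6) by auto
  from runs_While_True[OF this 1 2] show ?case
    by (rule runs_weaken) (auto simp: \<sigma>'_def fun_eq_iff add.assoc)
qed

definition bit_prog :: prog where
  "bit_prog = Seq (Pop 0) (Seq (incr 12 13 4) (Seq (copy 15 3 7) (Seq (Push 8 0)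
    (Seq (While_Nonempty 7 chunk_prog) (move_top 8 16)))))"

lemma runs_bit_prog:
  assumes \<sigma>: "scratch_empty \<sigma>" "\<sigma> 7 = []" "\<sigma> 8 = []" "length (\<sigma> 5) = L" "length (\<sigma> 3) = D * (3 * L)" "1 \<le> L"
    and i: "\<sigma> 4 = bin i" "blen (Suc i) \<le> L"
  shows "runs bit_prog \<sigma> (D * (30 * L * L + 64 * L + 13) + 27 * D * L + 8 * L + 16)
    (\<sigma>(0 := tl (\<sigma> 0), 4 := bin (Suc i), 16 := chunks L (bin (Suc i)) D (\<sigma> 3) # \<sigma> 16))"
proof -
  define \<sigma>1 where "\<sigma>1 = \<sigma>(0 := tl (\<sigma> 0))"
  define \<sigma>2 where "\<sigma>2 = \<sigma>1(4 := bin (Suc i))"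
  define \<sigma>3 where "\<sigma>3 = \<sigma>2(7 := \<sigma> 3)"
  define \<sigma>4 where "\<sigma>4 = \<sigma>3(8 := [0])"
  define \<sigma>5 where "\<sigma>5 = \<sigma>4(8 := [0 + chunks L (\<sigma>4 4) D (\<sigma>4 7)], 7 := [])"
  note defs = \<sigma>1_def \<sigma>2_def \<sigma>3_def \<sigma>4_def \<sigma>5_def
  have "length (bin i) \<le> L" using i(2) blen_mono[of i "Suc i"] by (simp add: blen_def)
  then have 2: "runs (incr 12 13 4) \<sigma>1 (8 * L + 8) \<sigma>2"
    by (intro runs_weaken[OF runs_incr]) (use \<sigma> i in \<open>auto simp: scratch_empty_def defs bin_Suc\<close>)
  have 3: "runs (copy 15 3 7) \<sigma>2 (27 * D * L + 2) \<sigma>3"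
    by (rule runs_weaken[OF runs_copy]) (use \<sigma> in \<open>auto simp: scratch_empty_def defs\<close>)
  have 4: "runs (Push 8 0) \<sigma>3 1 \<sigma>4"
    by (rule runs_weaken[OF runs_Push]) (use \<sigma> in \<open>auto simp: defs\<close>)
  have 5: "runs (While_Nonempty 7 chunk_prog) \<sigma>4 (D * (30 * L * L + 64 * L + 13) + 1) \<sigma>5"
    unfolding \<sigma>5_def by (rule runs_chunks) (use \<sigma> i in \<open>auto simp: scratch_empty_def defs blen_def\<close>)
  have 6: "runs (move_top 8 16) \<sigma>5 3 (\<sigma>5(8 := [], 16 := chunks L (bin (Suc i)) D (\<sigma> 3) # \<sigma> 16))"
    by (rule runs_weaken[OF runs_move_top]) (auto simp: defs)
  have 1: "runs (Pop 0) \<sigma> 1 \<sigma>1"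
    unfolding \<sigma>1_def by (rule runs_Pop)
  from runs_Seq[OF 1 runs_Seq[OF 2 runs_Seq[OF 3 runs_Seq[OF 4 runs_Seq[OF 5 6]]]]]
  show ?thesis
    unfolding bit_prog_def by (rule runs_weaken) (use \<sigma> in \<open>auto simp: defs fun_eq_iff\<close>)
qed

text \<open>Counting up to \<open>n\<close> in binary is affordable because \<open>n\<close> is
  given in unary. The final \<open>emit\<close> doubles the length of the counter and also empties
  it, so that the generator can count afresh.\<close>

definition count_prog :: prog where
  "count_prog = Seq (copy 15 0 6) (Seq (While_Nonempty 6 (Seq (Pop 6) (incr 12 13 4))) (emit 2 4 5))"

lemma runs_count_prog:
  assumes \<sigma>: "\<And>r. r \<in> {4, 5, 6, 12, 13, 15} \<Longrightarrow> \<sigma> r = []" and n: "length (\<sigma> 0) = n"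
  shows "runs count_prog \<sigma> (8 * n * n + 24 * n + 4) (\<sigma>(5 := unary (2 * blen n)))"
proof -
  define S where "S i = \<sigma>(6 := drop i (\<sigma> 0), 4 := bin i)" for i
  have 1: "runs (copy 15 0 6) \<sigma> (9 * n + 2) (S 0)"
    by (rule runs_weaken[OF runs_copy]) (use \<sigma> n in \<open>auto simp: S_def fun_eq_iff\<close>)
  have 2: "runs (While_Nonempty 6 (Seq (Pop 6) (incr 12 13 4))) (S 0) (n * ((8 * n + 9) + 1) + 1) (S n)"
  proof (rule runs_While)
    fix i assume i: "i < n"
    show "S i 6 \<noteq> []" using i n by (simp add: S_def)
    have "length (bin i) \<le> n"
      using blen_le_self[of i] i by (simp add: blen_def)
    then show "runs (Seq (Pop 6) (incr 12 13 4)) (S i) (8 * n + 9) (S (Suc i))"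
      by (intro runs_weaken[OF runs_Seq[OF runs_Pop runs_incr]])
         (use \<sigma> in \<open>auto simp: S_def fun_eq_iff bin_Suc drop_Suc tl_drop\<close>)
  qed (use n in \<open>simp add: S_def\<close>)
  have 3: "runs (emit 2 4 5) (S n) (5 * n + 1) (\<sigma>(5 := unary (2 * blen n)))"
    by (rule runs_weaken[OF runs_emit]) (use \<sigma> n blen_le_self[of n] in \<open>auto simp: S_def fun_eq_iff blen_def\<close>)
  show ?thesis
    unfolding count_prog_def
    by (rule runs_weaken[OF runs_Seq[OF 1 runs_Seq[OF 2 3]]]) (auto simp: algebra_simps)
qed

definition gen_prog :: prog where
  "gen_prog = Seq count_prog (Seq (While_Nonempty 0 bit_prog) (move 16 0))"

lemma runs_gen_prog:
  assumes n: "n \<ge> 1" and u: "length u = D * (3 * (2 * blen n))" and D: "D \<le> M" "n \<le> M"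
  shows "\<exists>\<sigma>'. runs gen_prog (initial_store [unary n, unary d, unary k, u]) (1000 * (M + 1) ^ 4) \<sigma>' \<and>
    \<sigma>' 0 = out n (2 * blen n) D u"
proof -
  define L where "L = 2 * blen n"
  define \<sigma> where "\<sigma> = initial_store [unary n, unary d, unary k, u]"
  have \<sigma>: "\<sigma> 0 = unary n" "\<sigma> 3 = u" "\<And>r. r \<ge> 4 \<Longrightarrow> \<sigma> r = []"
    by (auto simp: \<sigma>_def initial_store_def)
  have L: "1 \<le> L" "L \<le> 2 * M" using blen_pos[OF n] blen_le_self[of n] D by (auto simp: L_def)
  define S where "S i = \<sigma>(5 := unary L, 0 := drop i (unary n), 4 := bin i,
      16 := rev (map (\<lambda>j. chunks L (bin (Suc j)) D u) [0..<i]))" for i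
  define T where "T = D * (30 * L * L + 64 * L + 13) + 27 * D * L + 8 * L + 16"
  have 1: "runs count_prog \<sigma> (8 * n * n + 24 * n + 4) (S 0)"
    by (rule runs_weaken[OF runs_count_prog]) (use \<sigma> in \<open>auto simp: S_def L_def fun_eq_iff\<close>)
  have 2: "runs (While_Nonempty 0 bit_prog) (S 0) (n * (T + 1) + 1) (S n)"
  proof (rule runs_While)
    fix i assume i: "i < n"
    show "S i 0 \<noteq> []" using i by (simp add: S_def unary_def)
    have "blen (Suc i) \<le> L" using i blen_mono[of "Suc i" n] by (simp add: L_def)
    then show "runs bit_prog (S i) T (S (Suc i))"
      unfolding T_def using L(1) u
      by (intro runs_weaken[OF runs_bit_prog[where i = i and L = L and D = D]])
         (auto simp: S_def \<sigma> scratch_empty_def fun_eq_iff drop_Suc tl_drop L_def)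
  qed (simp add: S_def unary_def)
  have 3: "runs (move 16 0) (S n) (4 * n + 1) ((S n)(16 := [], 0 := out n L D u))"
    by (rule runs_weaken[OF runs_move]) (auto simp: S_def out_def unary_def)
  define m where "m = M + 1"
  \<comment> \<open>Here \<open>m\<close> bounds \<open>D\<close> and \<open>2 * m\<close> bounds
    \<open>L\<close>; being positive, \<open>m\<close> lets lower powers be absorbed into the
    highest.\<close>
  have "T \<le> m * (30 * (2 * m) * (2 * m) + 64 * (2 * m) + 13) + 27 * m * (2 * m) + 8 * (2 * m) + 16"
    unfolding T_def using L D by (intro add_mono mult_mono) (auto simp: m_def)
  also have "\<dots> = 120 * m ^ 3 + 182 * m ^ 2 + 29 * m + 16"
    by (simp add: algebra_simps power2_eq_square power3_eq_cube)
  also have "\<dots> \<le> 120 * m ^ 3 + 182 * m ^ 3 + 29 * m ^ 3 + 16 * m ^ 3"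
    by (intro add_mono mult_le_mono2 power_increasing self_le_power) (auto simp: m_def)
  finally have T: "T \<le> 347 * m ^ 3" by simp
  have m1: "1 \<le> m ^ 3" "m ^ 3 \<le> m ^ 4" "m \<le> m ^ 4" "m * m \<le> m ^ 4" "1 \<le> m ^ 4"
    by (auto simp: m_def power_increasing self_le_power simp flip: power2_eq_square)
  have "n \<le> m" "T + 1 \<le> 348 * m ^ 3"
    using T m1(1) D by (simp add: m_def, linarith)
  then have "n * (T + 1) \<le> m * (348 * m ^ 3)"
    by (rule mult_le_mono)
  then have "n * (T + 1) \<le> 348 * m ^ 4" by (simp add: power4_eq_xxxx power3_eq_cube)
  moreover have "n * n \<le> m * m" using \<open>n \<le> m\<close> \<open>n \<le> m\<close> by (rule mult_le_mono)
  moreover note \<open>n \<le> m\<close>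
  ultimately have "8 * n * n + 24 * n + 4 + (n * (T + 1) + 1 + (4 * n + 1)) \<le> 1000 * m ^ 4"
    using m1 by linarith
  with runs_Seq[OF 1 runs_Seq[OF 2 3]] show ?thesis
    unfolding gen_prog_def \<sigma>_def[symmetric] L_def[symmetric] m_def[symmetric]
    by (intro exI[of _ "(S n)(16 := [], 0 := out n L D u)"]) (auto elim: runs_weaken)
qed

subsection \<open>The seed length as a program\<close>

text \<open>Source and target of \<open>emit\<close> must differ, so the number goes to stack 7 and
  doubles on its way back.\<close>

definition double_prog :: prog where
  "double_prog = Seq (Pop 6) (Seq (emit 1 2 7) (emit 2 7 2))"

text \<open>The seed length is 48 times the product of \<open>2 * blen n\<close>, \<open>d\<close>
  and \<open>k * 2 ^ d\<close>. Products of variable numbers are formed by repeated copying.\<close>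

definition len_prog :: prog where
  "len_prog = Seq count_prog (Seq (clear 0) (Seq (copy 15 1 6) (Seq (While_Nonempty 6 double_prog)
    (Seq (While_Nonempty 1 (Seq (Pop 1) (copy 15 2 7)))
    (Seq (While_Nonempty 5 (Seq (Pop 5) (copy 15 7 8))) (emit 48 8 0))))))"

lemma tl_unary: "tl (unary a) = unary (a - 1)"
  by (cases a) (simp_all add: unary_def)

text \<open>
  The precision \<open>k\<close> is doubled \<open>d\<close> times, instead of computing \<open>2\<^sup>d\<close> separately: for \<open>k = 0\<close> the
  seed is empty and there is no time for \<open>2\<^sup>d\<close> steps.
\<close>

lemma runs_len_prog:
  assumes n: "n \<ge> 1" and M: "n + d + k + seed_len n d k \<le> M"
  shows "\<exists>\<sigma>'. runs len_prog (initial_store [unary n, unary d, unary k]) (1000 * (M + 1) ^ 4) \<sigma>' \<and>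
    \<sigma>' 0 = unary (seed_len n d k)"
proof -
  define l where "l = blen n"
  define K where "K = k * 2 ^ d"
  have s: "seed_len n d k = 48 * ((2 * l) * (d * K))"
    by (simp add: seed_len_def copies_def l_def K_def)
  have l: "1 \<le> l" "l \<le> n" using blen_pos[OF n] blen_le_self[of n] by (auto simp: l_def)
  have dK: "d * K \<le> M"
  proof -
    have "1 * (d * K) \<le> (96 * l) * (d * K)" using l by (intro mult_le_mono1) simp
    then have "d * K \<le> seed_len n d k" by (simp add: s algebra_simps)
    then show ?thesis using M by simp
  qed
  \<comment> \<open>For positive \<open>d\<close> the doubled precision is bounded by the seed
    length through \<open>d * K\<close>; for \<open>d = 0\<close> it is still
    \<open>k\<close>.\<close>
  have K: "K \<le> M"
  proof (cases "d = 0")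
    case True
    then show ?thesis using M by (simp add: K_def)
  next
    case False
    then have "K \<le> d * K" by simp
    with dK show ?thesis by linarith
  qed
  define \<sigma> where "\<sigma> = initial_store [unary n, unary d, unary k]"
  have \<sigma>: "\<sigma> 0 = unary n" "\<sigma> 1 = unary d" "\<sigma> 2 = unary k" "\<And>r. r \<ge> 3 \<Longrightarrow> \<sigma> r = []"
    by (auto simp: \<sigma>_def initial_store_def)
  define \<sigma>1 where "\<sigma>1 = \<sigma>(0 := [], 5 := unary (2 * l))"
  define S where "S i = \<sigma>1(2 := unary (k * 2 ^ i), 6 := unary (d - i))" for i
  define R where "R i = \<sigma>1(2 := unary K, 1 := unary (d - i), 7 := unary (i * K))" for i
  define Q where "Q i = \<sigma>1(2 := unary K, 1 := [], 7 := unary (d * K), 5 := unary (2 * l - i),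
      8 := unary (i * (d * K)))" for i
  have 1: "runs count_prog \<sigma> (8 * n * n + 24 * n + 4) (\<sigma>(5 := unary (2 * l)))"
    unfolding l_def by (rule runs_count_prog) (use \<sigma> in auto)
  have 2: "runs (clear 0) (\<sigma>(5 := unary (2 * l))) (2 * n + 1) \<sigma>1"
    by (rule runs_weaken[OF runs_clear]) (use \<sigma> in \<open>auto simp: \<sigma>1_def fun_eq_iff\<close>)
  have 3: "runs (copy 15 1 6) \<sigma>1 (9 * d + 2) (S 0)"
    by (rule runs_weaken[OF runs_copy]) (use \<sigma> in \<open>auto simp: \<sigma>1_def S_def fun_eq_iff\<close>)
  have 4: "runs (While_Nonempty 6 double_prog) (S 0) (d * ((9 * M + 3) + 1) + 1) (S d)"
  proof (rule runs_While)
    fix i assume i: "i < d"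
    show "S i 6 \<noteq> []" using i by (simp add: S_def unary_def)
    have "k * 2 ^ i \<le> K" unfolding K_def using i by (intro mult_le_mono2 power_increasing) auto
    then have "k * 2 ^ i \<le> M" using K by simp
    then show "runs double_prog (S i) (9 * M + 3) (S (Suc i))"
      unfolding double_prog_def
      by (intro runs_weaken[OF runs_Seq[OF runs_Pop runs_Seq[OF runs_emit runs_emit]]])
         (use \<sigma> in \<open>auto simp: S_def \<sigma>1_def fun_eq_iff tl_unary algebra_simps\<close>)
  qed (simp add: S_def)
  have SR: "S d = R 0"
    using \<sigma> by (auto simp: S_def R_def K_def \<sigma>1_def fun_eq_iff)
  have 5: "runs (While_Nonempty 1 (Seq (Pop 1) (copy 15 2 7))) (R 0) (d * ((9 * M + 3) + 1) + 1) (R d)"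
  proof (rule runs_While)
    fix i assume i: "i < d"
    show "R i 1 \<noteq> []" using i by (simp add: R_def unary_def)
    show "runs (Seq (Pop 1) (copy 15 2 7)) (R i) (9 * M + 3) (R (Suc i))"
      by (rule runs_weaken[OF runs_Seq[OF runs_Pop runs_copy]])
         (use \<sigma> K in \<open>auto simp: R_def \<sigma>1_def fun_eq_iff tl_unary unary_append\<close>)
  qed (simp add: R_def)
  have RQ: "R d = Q 0"
    using \<sigma> by (auto simp: R_def Q_def \<sigma>1_def fun_eq_iff)
  have 6: "runs (While_Nonempty 5 (Seq (Pop 5) (copy 15 7 8))) (Q 0) (2 * l * ((9 * M + 3) + 1) + 1) (Q (2 * l))"
  proof (rule runs_While)
    fix i assume i: "i < 2 * l"
    show "Q i 5 \<noteq> []" using i by (simp add: Q_def unary_def)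
    show "runs (Seq (Pop 5) (copy 15 7 8)) (Q i) (9 * M + 3) (Q (Suc i))"
      by (rule runs_weaken[OF runs_Seq[OF runs_Pop runs_copy]])
         (use \<sigma> dK in \<open>auto simp: Q_def \<sigma>1_def fun_eq_iff tl_unary unary_append\<close>)
  qed (simp add: Q_def)
  have "51 * (2 * l * (d * K)) \<le> 2 * seed_len n d k" by (simp add: s)
  also have "\<dots> \<le> 2 * M" using M by simp
  finally have 7: "runs (emit 48 8 0) (Q (2 * l)) (2 * M + 1)
      ((Q (2 * l))(8 := [], 0 := unary (seed_len n d k)))"
    by (intro runs_weaken[OF runs_emit]) (use \<sigma> in \<open>auto simp: Q_def \<sigma>1_def s\<close>)
  define m where "m = M + 1"
  have b: "n \<le> m" "d \<le> m" "l \<le> m" "M \<le> m" "1 \<le> m" "k \<le> m" using M l by (auto simp: m_def)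
  have m4: "m * m \<le> m ^ 4" "m \<le> m ^ 4" "1 \<le> m ^ 4"
    by (auto simp: m_def power_increasing self_le_power simp flip: power2_eq_square)
  have "n * n \<le> m * m" "d * M \<le> m * m" "l * M \<le> m * m" using b by (auto intro: mult_le_mono)
  then have "8 * n * n + 24 * n + 4 + (2 * n + 1 + (9 * d + 2 + (d * ((9 * M + 3) + 1) + 1 +
      (d * ((9 * M + 3) + 1) + 1 + (2 * l * ((9 * M + 3) + 1) + 1 + (2 * M + 1)))))) \<le> 1000 * m ^ 4"
    using b m4 by (simp add: algebra_simps)
  with runs_Seq[OF 1 runs_Seq[OF 2 runs_Seq[OF 3 runs_Seq[OF 4[unfolded SR] runs_Seq[OF 5[unfolded RQ] runs_Seq[OF 6 7]]]]]]
  show ?thesis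
    unfolding len_prog_def \<sigma>_def[symmetric] m_def[symmetric]
    by (intro exI[of _ "(Q (2 * l))(8 := [], 0 := unary (seed_len n d k))"]) (auto elim: runs_weaken)
qed

lemma copies_le_seed_len: "n \<ge> 1 \<Longrightarrow> copies d k \<le> seed_len n d k"
  using blen_pos[of n] by (simp add: seed_len_def)

lemma runs_imp_computes_within:
  "runs c (initial_store args) T \<sigma> \<Longrightarrow> \<sigma> 0 = y \<Longrightarrow> T \<le> T' \<Longrightarrow> computes_within c args y T'"
  unfolding runs_def computes_within_def by (metis order_trans)

theorem explicit_gen:
  "explicit (\<lambda>n d \<epsilon>. seed_len n d (precision \<epsilon>)) (\<lambda>n d \<epsilon>. gen n d (precision \<epsilon>))"
  unfolding explicit_def Let_def
proof (rule exI[of _ gen_prog], rule exI[of _ len_prog], rule exI[of _ 1000], intro allI impI conjI ballI)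
  fix n d :: nat and \<epsilon> :: real
  assume n: "n \<ge> 1" and "\<epsilon> > 0"
  define k where "k = precision \<epsilon>"
  define M where "M = n + d + k + seed_len n d k"
  \<comment> \<open>In \<open>explicit\<close> one constant is both factor and exponent, so the
    fourth power is raised to match the factor 1000.\<close>
  have T: "1000 * (M + 1) ^ 4 \<le> 1000 * (M + 1) ^ 1000"
    by (intro mult_le_mono2 power_increasing) auto
  show "computes_within len_prog [unary n, unary d, unary (precision \<epsilon>)] (unary (seed_len n d (precision \<epsilon>)))
      (1000 * (n + d + precision \<epsilon> + seed_len n d (precision \<epsilon>) + 1) ^ 1000)"
    using runs_len_prog[OF n, of d k M] T unfolding k_def[symmetric] M_def[symmetric]
    by (auto intro: runs_imp_computes_within simp: M_def)
  fix u assume u: "u \<in> cube (seed_len n d (precision \<epsilon>))"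
  have "copies d k \<le> M" "n \<le> M" using copies_le_seed_len[OF n, of d k] by (auto simp: M_def)
  moreover have "length u = copies d k * (3 * (2 * blen n))"
    using u by (simp add: k_def seed_len_def)
  ultimately show "computes_within gen_prog [unary n, unary d, unary (precision \<epsilon>), u] (gen n d (precision \<epsilon>) u)
      (1000 * (n + d + precision \<epsilon> + seed_len n d (precision \<epsilon>) + 1) ^ 1000)"
    using runs_gen_prog[OF n, of u "copies d k" M d k] T unfolding k_def[symmetric] M_def[symmetric]
    by (auto intro: runs_imp_computes_within simp: gen_def)
qed

theorem theorem5p2:
  shows "\<exists>C::real. \<exists>(s :: nat \<Rightarrow> nat \<Rightarrow> real \<Rightarrow> nat) (G :: nat \<Rightarrow> nat \<Rightarrow> real \<Rightarrow> bit list \<Rightarrow> bit list).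
    explicit s G \<and>
    (\<forall>(n::nat) (d::nat) (\<epsilon>::real). n \<ge> 1 \<longrightarrow> \<epsilon> > 0 \<longrightarrow>
       is_prg (f2_polys d n) n \<epsilon> (map_pmf (G n d \<epsilon>) (uniform (s n d \<epsilon>))) \<and>
       real (s n d \<epsilon>)
         \<le> 2 powr (C * real d) * lg (lg (real n) / \<epsilon>) ^ 3 * lg (real n / \<epsilon>))"
  by (intro exI[of _ 12] exI[of _ "\<lambda>n d \<epsilon>. seed_len n d (precision \<epsilon>)"]
      exI[of _ "\<lambda>n d \<epsilon>. gen n d (precision \<epsilon>)"] conjI explicit_gen allI impI gen_is_prg seed_len_bound)

end
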